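(* Let $(X,\mathscr A,\mu)$ be a $\sigma$-finite measure space and let $\phi$ be a nonsingular transformation of $X$. Then the following conditions are equivalent: (i) $C_\phi$ generates Stieltjes moment sequences; (ii) $\{\mathsf h_{\phi^n}(x)\}_{n=0}^\infty$ is a Stieltjes moment sequence for $\mu$-a.e. $x\in X$; (iii) $\mathcal D(C_\phi^k)$ is dense in $L^2(\mu)$ for all $k\in\mathbb N$, and $\{\mu(\phi^{-n}(\Delta))\}_{n=0}^\infty$ is a Stieltjes moment sequence for every $\Delta\in\mathscr A$ such that $\mu(\phi^{-k}(\Delta))<\infty$ for all $k\in\mathbb Z_+$; (iv) $\mathsf h_{\phi^n}<\infty$ a.e. $[\mu]$ for all $n\in\mathbb N$, and $L(p)\ge 0$ a.e. $[\mu]$ for every $p\in\mathbb C[t]$ such that $p(t)\ge 0$ for all $t\in[0,\infty)$, where $L\colon\mathbb C[t]\to\mathcal M$ is the linear mapping determined by $L(t^n)=\mathsf h_{\phi^n}$ for $n\in\mathbb Z_+$ (the functions $\mathsf h_{\phi^n}$ being modified on sets of $\mu$-measure zero so that $0\le\mathsf h_{\phi^n}(x)<\infty$ for all $x\in X$ and $n\in\mathbb Z_+$), $\mathbb C[t]$ is the set of all complex polynomials in one real variable $t$, and $\mathcal M$ is the set of all $\mathscr A$-measurable complex functions on $X$. Moreover, if (i) holds, then $C_\phi^n=C_{\phi^n}$ and $\mathcal D^\infty(C_\phi)$ is a core for $C_\phi^n$ for all $n\in\mathbb Z_+$.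
   Context: $\mathbb N=\{1,2,\dots\}$, $\mathbb Z_+=\{0,1,2,\dots\}$. $L^2(\mu)$ is the complex Hilbert space of square integrable complex functions on $X$. A transformation $\phi\colon X\to X$ is $\mathscr A$-measurable if $\phi^{-1}(\Delta)\in\mathscr A$ for all $\Delta\in\mathscr A$; it is nonsingular if it is $\mathscr A$-measurable and the measure $\mu\circ\phi^{-1}$, $\Delta\mapsto\mu(\phi^{-1}(\Delta))$, is absolutely continuous with respect to $\mu$. For nonsingular $\phi$, the composition operator $C_\phi$ in $L^2(\mu)$ is given by $\mathcal D(C_\phi)=\{f\in L^2(\mu)\colon f\circ\phi\in L^2(\mu)\}$, $C_\phi f=f\circ\phi$ (possibly unbounded, not assumed densely defined), and $\mathsf h_\phi\colon X\to[0,\infty]$ is the ($\mu$-a.e. unique) $\mathscr A$-measurable function with $\mu(\phi^{-1}(\Delta))=\int_\Delta\mathsf h_\phi\,d\mu$ for all $\Delta\in\mathscr A$. $\phi^n$ is the $n$-fold composition of $\phi$ with itself ($\phi^0$ is the identity), which is again nonsingular, and $\phi^{-n}(\Delta)=(\phi^n)^{-1}(\Delta)$. For an operator $A$, $\mathcal D(A)$ is its domain, powers $A^n$ have their natural domains, and $\mathcal D^\infty(A)=\bigcap_{n=0}^\infty\mathcal D(A^n)$. A vector subspace $\mathcal E\subseteq\mathcal D(A)$ is a core for $A$ if it is dense in $\mathcal D(A)$ with respect to the graph norm $(\|f\|^2+\|Af\|^2)^{1/2}$. A sequence $\{\gamma_n\}_{n=0}^\infty$ of real numbers is a Stieltjes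 moment sequence if there is a positive Borel measure $\rho$ on $[0,\infty)$ with $\gamma_n=\int_{[0,\infty)}s^n\,d\rho(s)$ for all $n\in\mathbb Z_+$. An operator $S$ in a complex Hilbert space $\mathcal H$ generates Stieltjes moment sequences if $\mathcal D^\infty(S)$ is dense in $\mathcal H$ and $\{\|S^nf\|^2\}_{n=0}^\infty$ is a Stieltjes moment sequence for every $f\in\mathcal D^\infty(S)$. *)

theory Defs
  imports "HOL-Analysis.Analysis" "HOL-Computational_Algebra.Polynomial"
begin

section \<open>The space of square integrable functions modulo equality almost everywhere\<close>

definition square_integrable :: "'a measure \<Rightarrow> ('a \<Rightarrow> complex) set" where
  "square_integrable M = {f \<in> borel_measurable M. integrable M (\<lambda>x. (cmod (f x))\<^sup>2)}"

definition L2_class :: "'a measure \<Rightarrow> ('a \<Rightarrow> complex) \<Rightarrow> ('a \<Rightarrow> complex) set" where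
  "L2_class M f = {g \<in> square_integrable M. AE x in M. g x = f x}"

definition L2 :: "'a measure \<Rightarrow> ('a \<Rightarrow> complex) set set" where
  "L2 M = L2_class M ` square_integrable M"

definition L2_rep :: "('a \<Rightarrow> complex) set \<Rightarrow> 'a \<Rightarrow> complex" where
  "L2_rep F = (SOME f. f \<in> F)"

definition L2_zero :: "'a measure \<Rightarrow> ('a \<Rightarrow> complex) set" where
  "L2_zero M = L2_class M (\<lambda>x. 0)"

definition L2_add ::
    "'a measure \<Rightarrow> ('a \<Rightarrow> complex) set \<Rightarrow> ('a \<Rightarrow> complex) set \<Rightarrow> ('a \<Rightarrow> complex) set" where
  "L2_add M F G = L2_class M (\<lambda>x. L2_rep F x + L2_rep G x)"

definition L2_diff ::
    "'a measure \<Rightarrow> ('a \<Rightarrow> complex) set \<Rightarrow> ('a \<Rightarrow> complex) set \<Rightarrow> ('a \<Rightarrow> complex) set" where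
  "L2_diff M F G = L2_class M (\<lambda>x. L2_rep F x - L2_rep G x)"

definition L2_scale ::
    "'a measure \<Rightarrow> complex \<Rightarrow> ('a \<Rightarrow> complex) set \<Rightarrow> ('a \<Rightarrow> complex) set" where
  "L2_scale M c F = L2_class M (\<lambda>x. c * L2_rep F x)"

definition L2_norm :: "'a measure \<Rightarrow> ('a \<Rightarrow> complex) set \<Rightarrow> real" where
  "L2_norm M F = sqrt (\<integral>x. (cmod (L2_rep F x))\<^sup>2 \<partial>M)"

definition L2_dense :: "'a measure \<Rightarrow> ('a \<Rightarrow> complex) set set \<Rightarrow> bool" where
  "L2_dense M E \<longleftrightarrow> E \<subseteq> L2 M \<and>
     (\<forall>F \<in> L2 M. \<forall>\<epsilon>>0. \<exists>G \<in> E. L2_norm M (L2_diff M F G) < \<epsilon>)"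

definition L2_subspace :: "'a measure \<Rightarrow> ('a \<Rightarrow> complex) set set \<Rightarrow> bool" where
  "L2_subspace M E \<longleftrightarrow> E \<subseteq> L2 M \<and> L2_zero M \<in> E \<and>
     (\<forall>F \<in> E. \<forall>G \<in> E. L2_add M F G \<in> E) \<and> (\<forall>c. \<forall>F \<in> E. L2_scale M c F \<in> E)"


section \<open>Unbounded operators\<close>

text \<open>An operator is a partial map on \<open>L2 M\<close>: its domain is \<open>dom A\<close>, and equality of
  operators includes equality of their domains.\<close>

type_synonym 'a L2_operator = "('a \<Rightarrow> complex) set \<rightharpoonup> ('a \<Rightarrow> complex) set"

primrec op_power :: "'a measure \<Rightarrow> 'a L2_operator \<Rightarrow> nat \<Rightarrow> 'a L2_operator" where
  "op_power M A 0 = Some |` L2 M"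
| "op_power M A (Suc n) = A \<circ>\<^sub>m op_power M A n"

definition dom_infinity :: "'a measure \<Rightarrow> 'a L2_operator \<Rightarrow> ('a \<Rightarrow> complex) set set" where
  "dom_infinity M A = (\<Inter>n. dom (op_power M A n))"

definition is_core ::
    "'a measure \<Rightarrow> ('a \<Rightarrow> complex) set set \<Rightarrow> 'a L2_operator \<Rightarrow> bool" where
  "is_core M E A \<longleftrightarrow> L2_subspace M E \<and> E \<subseteq> dom A \<and>
     (\<forall>F \<in> dom A. \<forall>\<epsilon>>0. \<exists>G \<in> E.
        sqrt ((L2_norm M (L2_diff M F G))\<^sup>2
          + (L2_norm M (L2_diff M (the (A F)) (the (A G))))\<^sup>2) < \<epsilon>)"


section \<open>Stieltjes moment sequences\<close>

definition Stieltjes_moment_sequence :: "(nat \<Rightarrow> real) \<Rightarrow> bool" where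
  "Stieltjes_moment_sequence \<gamma> \<longleftrightarrow>
     (\<exists>\<rho> :: real measure. sets \<rho> = sets (restrict_space borel {0..}) \<and>
        (\<forall>n. has_bochner_integral \<rho> (\<lambda>s. s ^ n) (\<gamma> n)))"

definition generates_Stieltjes :: "'a measure \<Rightarrow> 'a L2_operator \<Rightarrow> bool" where
  "generates_Stieltjes M S \<longleftrightarrow> L2_dense M (dom_infinity M S) \<and>
     (\<forall>F \<in> dom_infinity M S.
        Stieltjes_moment_sequence (\<lambda>n. (L2_norm M (the (op_power M S n F)))\<^sup>2))"


section \<open>Composition operators\<close>

definition nonsingular :: "'a measure \<Rightarrow> ('a \<Rightarrow> 'a) \<Rightarrow> bool" where
  "nonsingular M \<phi> \<longleftrightarrow> \<phi> \<in> measurable M M \<and> absolutely_continuous M (distr M M \<phi>)"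

text \<open>For nonsingular \<open>\<phi>\<close> neither the condition nor the value depends on the
  representative of \<open>F\<close>.\<close>

definition comp_op :: "'a measure \<Rightarrow> ('a \<Rightarrow> 'a) \<Rightarrow> 'a L2_operator" where
  "comp_op M \<phi> F =
     (if F \<in> L2 M \<and> L2_rep F \<circ> \<phi> \<in> square_integrable M
      then Some (L2_class M (L2_rep F \<circ> \<phi>)) else None)"

definition h_fun :: "'a measure \<Rightarrow> ('a \<Rightarrow> 'a) \<Rightarrow> 'a \<Rightarrow> ennreal" where
  "h_fun M \<phi> = RN_deriv M (distr M M \<phi>)"

text \<open>The linear map determined by sending the monomial of degree \<open>n\<close> to \<open>h_fun M (\<phi> ^^ n)\<close>.
  Since \<open>enn2real \<infinity> = 0\<close>, applying \<open>enn2real\<close> replaces each of these functions, if it is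
  finite almost everywhere, by a finite-valued function that is equal to it almost everywhere.\<close>

definition poly_map :: "'a measure \<Rightarrow> ('a \<Rightarrow> 'a) \<Rightarrow> complex poly \<Rightarrow> 'a \<Rightarrow> complex" where
  "poly_map M \<phi> p x =
     (\<Sum>n\<le>degree p. coeff p n * complex_of_real (enn2real (h_fun M (\<phi> ^^ n) x)))"

lemma poly_map_superset:
  assumes "degree p \<le> N"
  shows "poly_map M \<phi> p x =
    (\<Sum>n\<le>N. coeff p n * complex_of_real (enn2real (h_fun M (\<phi> ^^ n) x)))"
  unfolding poly_map_def using assms
  by (intro sum.mono_neutral_left) (auto simp: coeff_eq_0)

lemma poly_map_add: "poly_map M \<phi> (p + q) x = poly_map M \<phi> p x + poly_map M \<phi> q x"
proof -
  define N where "N = max (degree p) (degree q)"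
  have "degree p \<le> N" "degree q \<le> N" "degree (p + q) \<le> N"
    unfolding N_def by (auto simp: degree_add_le)
  then show ?thesis
    by (simp add: poly_map_superset[of _ N] sum.distrib ring_distribs)
qed

lemma poly_map_smult: "poly_map M \<phi> (smult c p) x = c * poly_map M \<phi> p x"
  by (simp add: poly_map_superset[of _ "degree p"] degree_smult_le sum_distrib_left mult.assoc)

lemma poly_map_monom:
  "poly_map M \<phi> (monom 1 n) x = complex_of_real (enn2real (h_fun M (\<phi> ^^ n) x))"
  by (subst poly_map_superset[of _ n])
     (simp_all add: degree_monom_le if_distrib[of "\<lambda>c. c * _"] sum.delta cong: if_cong)

end

theory Submission
  imports Defs "HOL-Probability.Probability"
begin

text \<open>
  All four conditions are equivalent to the positivity of the functional sending \<open>t ^ n\<close> to the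
  Radon-Nikodym derivative \<open>h n\<close> of \<open>\<phi> ^^ n\<close> almost everywhere, on every polynomial that is
  nonnegative on the half-line. The bridge is the identity \<open>\<integral> u \<circ> \<phi>\<^sup>n = \<integral> h n * u\<close>: it turns
  squared norms of iterates and measures of iterated preimages into integrals of the \<open>h n\<close>, and
  localising to sets on which all \<open>h n\<close> are bounded gives pointwise positivity back.

  Positivity yields a measure by Haviland's theorem. Separation of a point from a convex set shows
  that finitely many moments can be approximated by finitely supported probability measures; these
  are tight, and a weak limit has the prescribed moments, because each moment is uniformly
  integrable thanks to the one of twice the order.
\<close>

section \<open>The Stieltjes moment problem on the half-line\<close>

text \<open>Two problems with null sets shape the argument. Positivity holds for each polynomial off
  its own null set, and there are uncountably many polynomials; a statement about almost every point
  becomes available only after reduction to rational coefficient lists, which are countable.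
  Likewise each \<open>h n\<close> is finite almost everywhere, but bounding one \<open>h n\<close>
  at a time does not produce vectors lying in the domain of every power. Borel-Cantelli supplies a
  single almost everywhere finite \<open>w\<close> that dominates every \<open>h n\<close> up to a
  constant; its sublevel sets serve both the approximation in graph norm and the localisation. The
  identity of powers is a separate matter. The domain of the n-th power demands that the
  intermediate composites be square integrable too, whereas \<open>comp_op M (\<phi> ^^ n)\<close>
  tests only the last one. On the half-line s^j \<le> 1 + s^n for j \<le> n, so the representing
  measures yield \<open>h j \<le> 1 + h n\<close> almost everywhere, which closes the gap.\<close>

text \<open>The Riesz functional of the sequence, with polynomials encoded as arbitrary coefficient
  functions cut off at \<open>N\<close>; this avoids any bookkeeping of degrees.\<close>

definition nonneg_functional :: "(nat \<Rightarrow> real) \<Rightarrow> bool" where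
  "nonneg_functional \<gamma> \<longleftrightarrow>
     (\<forall>N a. (\<forall>t\<ge>0. 0 \<le> (\<Sum>n<N. a n * t ^ n)) \<longrightarrow> 0 \<le> (\<Sum>n<N. a n * \<gamma> n))"

section \<open>Separation from a convex set, and approximate solution of finitely many moment
  conditions\<close>

text \<open>\<open>u\<close> is the point of least Euclidean norm in the closure of
  \<open>C\<close>, seen in the coordinates of \<open>I\<close> only. Minimality along segments from
  \<open>u\<close> to x gives u.x \<ge> |u|^2 \<ge> d.\<close>

lemma convex_separation_coordinates:
  fixes C :: "('i \<Rightarrow> real) set"
  assumes fin: "finite I" and ne: "C \<noteq> {}"
    and conv: "\<And>x y t. x \<in> C \<Longrightarrow> y \<in> C \<Longrightarrow> 0 \<le> t \<Longrightarrow> t \<le> 1 \<Longrightarrow> (\<lambda>i. x i + t * (y i - x i)) \<in> C"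
    and far: "\<And>x. x \<in> C \<Longrightarrow> d \<le> (\<Sum>i\<in>I. (x i)\<^sup>2)"
  obtains u where "\<And>x. x \<in> C \<Longrightarrow> d \<le> (\<Sum>i\<in>I. u i * x i)"
proof -
  define Q where "Q x = (\<Sum>i\<in>I. (x i)\<^sup>2)" for x :: "'i \<Rightarrow> real"
  define D where "D = (INF x\<in>C. Q x)"
  have bdd: "bdd_below (Q ` C)"
    using far by (auto simp: Q_def intro!: bdd_belowI2)
  have DQ: "D \<le> Q x" if "x \<in> C" for x
    unfolding D_def by (rule cINF_lower[OF bdd that])
  have "d \<le> D"
    unfolding D_def using ne far by (auto simp: Q_def intro!: cINF_greatest)
  have "\<exists>x\<in>C. Q x < D + 1 / real (Suc k)" for k
    using cInf_lessD[of "Q ` C" "D + 1 / real (Suc k)"] ne by (auto simp: D_def)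
  then obtain X where X: "\<And>k. X k \<in> C" "\<And>k. Q (X k) < D + 1 / real (Suc k)"
    by metis
  \<comment> \<open>The midpoint of \<open>X j\<close> and \<open>X k\<close> lies in
    \<open>C\<close>, so its squared norm is at least \<open>D\<close>; the parallelogram law then
    makes the minimising sequence Cauchy.\<close>
  have parallelogram: "Q (\<lambda>i. X j i - X k i) \<le> 2 / real (Suc j) + 2 / real (Suc k)" for j k
  proof -
    have "Q (\<lambda>i. X j i - X k i) + 4 * Q (\<lambda>i. X j i + (1/2) * (X k i - X j i))
        = 2 * Q (X j) + 2 * Q (X k)"
      unfolding Q_def sum_distrib_left sum.distrib[symmetric]
      by (intro sum.cong) (auto simp: power2_eq_square field_simps)
    moreover have "D \<le> Q (\<lambda>i. X j i + (1/2) * (X k i - X j i))"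
      by (intro DQ conv X) auto
    ultimately show ?thesis
      using X(2)[of j] X(2)[of k] by simp
  qed
  have "Cauchy (\<lambda>k. X k i)" if "i \<in> I" for i
  proof (rule metric_CauchyI)
    fix e :: real assume "0 < e"
    then obtain K where K: "4 / e\<^sup>2 < real K"
      using reals_Archimedean2 by blast
    have "dist (X j i) (X k i) < e" if "K \<le> j" "K \<le> k" for j k
    proof -
      have "(X j i - X k i)\<^sup>2 \<le> Q (\<lambda>i. X j i - X k i)"
        unfolding Q_def using \<open>i \<in> I\<close> fin by (intro member_le_sum) auto
      also have "\<dots> \<le> 2 / real (Suc j) + 2 / real (Suc k)"
        by (rule parallelogram)
      also have "\<dots> \<le> 2 / real (Suc K) + 2 / real (Suc K)"
        using that by (intro add_mono divide_left_mono) auto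
      also have "\<dots> = 4 / real (Suc K)"
        by simp
      also have "\<dots> < e\<^sup>2"
      proof -
        have "4 < real K * e\<^sup>2"
          using K \<open>0 < e\<close> by (simp add: divide_less_eq)
        also have "\<dots> \<le> real (Suc K) * e\<^sup>2"
          by (intro mult_right_mono) auto
        finally show ?thesis
          by (simp add: divide_less_eq mult.commute)
      qed
      finally have "\<bar>X j i - X k i\<bar>\<^sup>2 < e\<^sup>2"
        by simp
      then show ?thesis
        unfolding dist_real_def by (rule power2_less_imp_less) (use \<open>0 < e\<close> in simp)
    qed
    then show "\<exists>K. \<forall>j\<ge>K. \<forall>k\<ge>K. dist (X j i) (X k i) < e" by blast
  qed
  then have "\<exists>u. \<forall>i\<in>I. (\<lambda>k. X k i) \<longlonglongrightarrow> u i"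
    unfolding Cauchy_convergent_iff by (intro bchoice) (auto simp: convergent_def)
  then obtain u where u: "\<And>i. i \<in> I \<Longrightarrow> (\<lambda>k. X k i) \<longlonglongrightarrow> u i"
    by blast
  have "(\<lambda>k. Q (X k)) \<longlonglongrightarrow> D"
  proof (rule tendsto_sandwich[of "\<lambda>_. D" _ _ "\<lambda>k. D + 1 / real (Suc k)"])
    show "(\<lambda>k. D + 1 / real (Suc k)) \<longlonglongrightarrow> D"
      using tendsto_add[OF tendsto_const LIMSEQ_inverse_real_of_nat, of D]
      by (simp add: divide_inverse)
    show "\<forall>\<^sub>F k in sequentially. Q (X k) \<le> D + 1 / real (Suc k)"
      using X(2) by (intro always_eventually) (auto intro: less_imp_le)
  qed (auto intro!: always_eventually DQ X(1))
  moreover have "(\<lambda>k. Q (X k)) \<longlonglongrightarrow> Q u"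
    unfolding Q_def by (intro tendsto_sum tendsto_power u)
  ultimately have Qu: "Q u = D"
    by (rule LIMSEQ_unique[rotated])
  have "D \<le> (\<Sum>i\<in>I. u i * x i)" if "x \<in> C" for x
  proof -
    define A where "A = (\<Sum>i\<in>I. u i * (x i - u i))"
    define B where "B = Q (\<lambda>i. x i - u i)"
    \<comment> \<open>\<open>u\<close> itself may lie outside \<open>C\<close>, so minimality is
      used at \<open>X k\<close> and carried over to \<open>u\<close> by letting k grow. Division by
      t and t tending to 0 from the right then leave \<open>0 \<le> A\<close>.\<close>
    have *: "0 \<le> 2 * A + t * B" if t: "0 < t" "t \<le> 1" for t
    proof -
      have "D \<le> Q (\<lambda>i. X k i + t * (x i - X k i))" for k
        using t \<open>x \<in> C\<close> X by (intro DQ conv) auto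
      moreover have "(\<lambda>k. Q (\<lambda>i. X k i + t * (x i - X k i))) \<longlonglongrightarrow> Q (\<lambda>i. u i + t * (x i - u i))"
        unfolding Q_def by (intro tendsto_sum tendsto_power tendsto_add tendsto_mult tendsto_diff
            tendsto_const u)
      ultimately have "D \<le> Q (\<lambda>i. u i + t * (x i - u i))"
        using LIMSEQ_le_const by blast
      also have "\<dots> = Q u + t * (2 * A + t * B)"
        unfolding Q_def A_def B_def sum_distrib_left sum.distrib[symmetric]
        by (intro sum.cong) (auto simp: power2_eq_square algebra_simps)
      finally show ?thesis
        using Qu t by (simp add: zero_le_mult_iff)
    qed
    have "((\<lambda>t. 2 * A + t * B) \<longlongrightarrow> 2 * A + 0 * B) (at_right 0)"
      by (intro tendsto_intros)
    moreover have "\<forall>\<^sub>F t in at_right 0. 0 \<le> 2 * A + t * B"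
      using * by (auto simp: eventually_at_right_field intro!: exI[of _ 1])
    ultimately have "0 \<le> 2 * A + 0 * B"
      by (rule tendsto_lowerbound) auto
    moreover have "(\<Sum>i\<in>I. u i * x i) = A + Q u"
      unfolding A_def Q_def sum.distrib[symmetric]
      by (intro sum.cong) (auto simp: power2_eq_square algebra_simps)
    ultimately show ?thesis
      using Qu by simp
  qed
  then show thesis
    using \<open>d \<le> D\<close> that by (meson order_trans)
qed

text \<open>The errors of the moments of finitely supported probability measures form a convex set.
  If it kept distance \<open>e\<close> from 0, a separating vector, tested on point masses, would
  give a polynomial that is nonnegative on the half-line and on which the functional is
  negative.\<close>

lemma nonneg_functional_approx:
  assumes \<gamma>: "nonneg_functional \<gamma>" "\<gamma> 0 = 1" and "0 < e"
  obtains S w where "finite S" "S \<subseteq> {0..}" "\<And>s. s \<in> S \<Longrightarrow> 0 \<le> w s" "sum w S = 1"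
    "\<And>n. n \<le> N \<Longrightarrow> \<bar>(\<Sum>s\<in>S. w s * s ^ n) - \<gamma> n\<bar> \<le> e"
proof -
  define P where "P S w x \<longleftrightarrow> finite S \<and> S \<subseteq> {0..} \<and> (\<forall>s\<in>S. 0 \<le> w s) \<and> sum w S = 1 \<and>
    x = (\<lambda>n. (\<Sum>s\<in>S. w s * s ^ n) - \<gamma> n)" for S :: "real set" and w x
  define C where "C = {x. \<exists>S w. P S w x}"
  have dirac: "(\<lambda>n. s ^ n - \<gamma> n) \<in> C" if "0 \<le> s" for s
    unfolding C_def P_def using that by (auto intro!: exI[of _ "{s}"] exI[of _ "\<lambda>_. 1"])
  have conv: "(\<lambda>i. x i + t * (y i - x i)) \<in> C"
    if xy: "x \<in> C" "y \<in> C" "0 \<le> t" "t \<le> 1" for x y t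
  proof -
    obtain S w S' w' where *: "P S w x" "P S' w' y"
      using xy by (auto simp: C_def)
    \<comment> \<open>The mixture of the two weights, each extended by zero to the union of the
      supports.\<close>
    define v where "v s = (1 - t) * (if s \<in> S then w s else 0) + t * (if s \<in> S' then w' s else 0)"
      for s
    have fin: "finite S" "finite S'"
      using * by (auto simp: P_def)
    have v: "(\<Sum>s\<in>S \<union> S'. v s * f s) = (1 - t) * (\<Sum>s\<in>S. w s * f s) + t * (\<Sum>s\<in>S'. w' s * f s)"
      for f
    proof -
      have 1: "(\<Sum>s\<in>S \<union> S'. (if s \<in> S then w s else 0) * f s) = (\<Sum>s\<in>S. w s * f s)"
        using fin by (intro sum.mono_neutral_cong_right) auto
      have 2: "(\<Sum>s\<in>S \<union> S'. (if s \<in> S' then w' s else 0) * f s) = (\<Sum>s\<in>S'. w' s * f s)"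
        using fin by (intro sum.mono_neutral_cong_right) auto
      show ?thesis
        by (simp add: v_def distrib_right sum.distrib mult.assoc sum_distrib_left[symmetric] 1 2
            del: if_distribR)
    qed
    have "P (S \<union> S') v (\<lambda>i. x i + t * (y i - x i))"
      unfolding P_def
    proof (intro conjI)
      show "sum v (S \<union> S') = 1"
        using v[of "\<lambda>_. 1"] * by (simp add: P_def)
      show "(\<lambda>i. x i + t * (y i - x i)) = (\<lambda>n. (\<Sum>s\<in>S \<union> S'. v s * s ^ n) - \<gamma> n)"
        using * by (auto simp: v P_def algebra_simps)
      show "\<forall>s\<in>S \<union> S'. 0 \<le> v s"
        using * xy by (auto simp: v_def P_def)
    qed (use * in \<open>auto simp: P_def\<close>)
    then show ?thesis
      by (auto simp: C_def)
  qed
  have "\<exists>x\<in>C. (\<Sum>n\<le>N. (x n)\<^sup>2) < e\<^sup>2"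
  proof (rule ccontr)
    assume "\<not> ?thesis"
    then have far: "\<And>x. x \<in> C \<Longrightarrow> e\<^sup>2 \<le> (\<Sum>n\<le>N. (x n)\<^sup>2)"
      by (auto simp: not_less)
    have "C \<noteq> {}"
      using dirac[of 0] by auto
    from convex_separation_coordinates[OF finite_atMost this conv far]
    obtain u where u: "\<And>x. x \<in> C \<Longrightarrow> e\<^sup>2 \<le> (\<Sum>n\<le>N. u n * x n)"
      by blast
    \<comment> \<open>Subtracting \<open>b\<close> from the constant coefficient turns the
      separation inequality at the point mass in t into nonnegativity at t. Since
      \<open>\<gamma> 0 = 1\<close>, the same shift makes the functional take the value
      -e^2.\<close>
    define b where "b = e\<^sup>2 + (\<Sum>n\<le>N. u n * \<gamma> n)"
    define a where "a n = u n - (if n = 0 then b else 0)" for n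
    have a: "(\<Sum>n<Suc N. a n * f n) = (\<Sum>n\<le>N. u n * f n) - b" if "f 0 = 1" for f
      unfolding a_def lessThan_Suc_atMost using that
      by (simp add: left_diff_distrib sum_subtractf if_distrib[of "\<lambda>c. c * _"] sum.delta
          cong: if_cong)
    have "0 \<le> (\<Sum>n<Suc N. a n * t ^ n)" if "0 \<le> t" for t
      using u[OF dirac[OF that]] by (simp add: a b_def algebra_simps sum_subtractf del: sum.lessThan_Suc)
    then have "0 \<le> (\<Sum>n<Suc N. a n * \<gamma> n)"
      using \<gamma>(1) unfolding nonneg_functional_def by blast
    then show False
      using \<open>0 < e\<close> \<gamma>(2) by (simp add: a b_def del: sum.lessThan_Suc)
  qed
  then obtain S w x where *: "P S w x" "(\<Sum>n\<le>N. (x n)\<^sup>2) < e\<^sup>2"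
    by (auto simp: C_def)
  have "\<bar>x n\<bar> \<le> e" if "n \<le> N" for n
  proof -
    have "(x n)\<^sup>2 \<le> (\<Sum>n\<le>N. (x n)\<^sup>2)"
      using that by (intro member_le_sum) auto
    then show ?thesis
      using * \<open>0 < e\<close> by (intro power2_le_imp_le[of "\<bar>x n\<bar>"]) auto
  qed
  with * show thesis
    by (intro that[of S w]) (auto simp: P_def)
qed

section \<open>Weak limits of discrete distributions and Haviland's theorem\<close>

text \<open>The point measure carries the discrete sigma-algebra on \<open>S\<close>; pushing it
  forward along the identity gives a distribution on the Borel sets of the line, as weak convergence
  requires.\<close>

lemma finite_distribution:
  fixes w :: "real \<Rightarrow> real"
  assumes "finite S" and nonneg: "\<And>s. s \<in> S \<Longrightarrow> 0 \<le> w s" and sum: "sum w S = 1"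
  shows "\<exists>\<rho>. real_distribution \<rho> \<and>
    (\<forall>f :: real \<Rightarrow> real. f \<in> borel_measurable borel \<longrightarrow> integral\<^sup>L \<rho> f = (\<Sum>s\<in>S. w s * f s))"
proof (intro exI conjI allI impI)
  let ?p = "point_measure S (\<lambda>s. ennreal (w s))"
  have id: "(\<lambda>s. s) \<in> measurable ?p borel"
    by (simp add: measurable_def sets_point_measure space_point_measure)
  have "emeasure ?p (space ?p) = ennreal (sum w S)"
    using assms by (simp add: space_point_measure emeasure_point_measure_finite sum_ennreal)
  then have "prob_space ?p"
    using sum by (intro prob_spaceI) simp
  then have "prob_space (distr ?p borel (\<lambda>s. s))"
    using id by (rule prob_space.prob_space_distr)
  then show "real_distribution (distr ?p borel (\<lambda>s. s))"
    by (simp add: real_distribution_def real_distribution_axioms_def)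
  fix f :: "real \<Rightarrow> real" assume f: "f \<in> borel_measurable borel"
  have "integral\<^sup>L (distr ?p borel (\<lambda>s. s)) f = integral\<^sup>L ?p f"
    by (rule integral_distr[OF id f])
  also have "\<dots> = (\<Sum>s\<in>S. w s *\<^sub>R f s)"
    using assms by (intro lebesgue_integral_point_measure_finite) auto
  finally show "integral\<^sup>L (distr ?p borel (\<lambda>s. s)) f = (\<Sum>s\<in>S. w s * f s)"
    by simp
qed

lemma nonneg_functional_distribution:
  assumes \<gamma>: "nonneg_functional \<gamma>" "\<gamma> 0 = 1"
  obtains \<rho> where "real_distribution \<rho>" "AE s in \<rho>. 0 \<le> s"
    "\<And>n. has_bochner_integral \<rho> (\<lambda>s. s ^ n) (\<gamma> n)"
proof -
  define P where "P k S w \<longleftrightarrow> finite S \<and> S \<subseteq> {0..} \<and> (\<forall>s\<in>S. 0 \<le> w s) \<and> sum w S = 1 \<and>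
    (\<forall>n\<le>k. \<bar>(\<Sum>s\<in>S. w s * s ^ n) - \<gamma> n\<bar> \<le> 1 / real (Suc k))" for k S w
  have "\<exists>S w. P k S w" for k
  proof -
    have "0 < 1 / real (Suc k)" by simp
    from nonneg_functional_approx[OF \<gamma> this, of k] show ?thesis
      unfolding P_def by metis
  qed
  then obtain S w where "\<And>k. P k (S k) (w k)"
    by metis
  then have S: "\<And>k. finite (S k)" "\<And>k s. s \<in> S k \<Longrightarrow> 0 \<le> s"
    and w: "\<And>k s. s \<in> S k \<Longrightarrow> 0 \<le> w k s" "\<And>k. sum (w k) (S k) = 1"
    and approx: "\<And>k n. n \<le> k \<Longrightarrow> \<bar>(\<Sum>s\<in>S k. w k s * s ^ n) - \<gamma> n\<bar> \<le> 1 / real (Suc k)"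
    unfolding P_def subset_eq atLeast_iff by blast+
  have "\<forall>k. \<exists>\<rho>. real_distribution \<rho> \<and> (\<forall>f :: real \<Rightarrow> real. f \<in> borel_measurable borel \<longrightarrow>
      integral\<^sup>L \<rho> f = (\<Sum>s\<in>S k. w k s * f s))"
    by (intro allI finite_distribution) (use S w in auto)
  from choice[OF this] obtain \<mu> where \<mu>: "\<And>k. real_distribution (\<mu> k)"
    and int: "\<And>k f. f \<in> borel_measurable borel \<Longrightarrow>
      integral\<^sup>L (\<mu> k) f = (\<Sum>s\<in>S k. w k s * f s :: real)"
    by blast
  define m where "m n k = (\<Sum>s\<in>S k. w k s * s ^ n)" for n k
  have mom: "m n \<longlonglongrightarrow> \<gamma> n" for n
  proof -
    have "(\<lambda>k. m n k - \<gamma> n) \<longlonglongrightarrow> 0"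
    proof (rule Lim_null_comparison)
      show "\<forall>\<^sub>F k in sequentially. norm (m n k - \<gamma> n) \<le> 1 / real (Suc k)"
        using approx[of n] unfolding eventually_sequentially m_def real_norm_def by blast
      show "(\<lambda>k. 1 / real (Suc k)) \<longlonglongrightarrow> 0"
        using LIMSEQ_inverse_real_of_nat by (simp add: divide_inverse)
    qed
    then show ?thesis
      by (simp add: LIM_zero_iff)
  qed
  obtain B where B: "0 < B" "\<And>k. m 1 k \<le> B"
    using convergent_imp_Bseq[of "m 1"] mom[of 1] unfolding convergent_def Bseq_def
    by (auto simp: abs_le_iff)
  have "tight \<mu>"
    unfolding tight_def
  proof (intro conjI allI impI \<mu>)
    fix e :: real assume "0 < e"
    \<comment> \<open>By Markov's inequality the mass beyond \<open>b\<close> is at most B / b = e /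
      2. The half-open interval starts at -1 so that an atom at 0 is counted.\<close>
    define b where "b = 2 * B / e"
    have "0 < b"
      using \<open>0 < e\<close> B by (simp add: b_def)
    have "1 - e < measure (\<mu> k) {-1<..b}" for k
    proof -
      interpret real_distribution "\<mu> k" by (rule \<mu>)
      have "m 1 k / b \<le> B / b"
        using B \<open>0 < b\<close> by (intro divide_right_mono) auto
      also have "\<dots> < e"
        using \<open>0 < e\<close> B by (simp add: b_def)
      finally have "1 - e < 1 - m 1 k / b" by simp
      also have "\<dots> = (\<Sum>s\<in>S k. w k s * (1 - s / b))"
        using w(2) by (simp add: m_def right_diff_distrib sum_subtractf sum_divide_distrib)
      also have "\<dots> \<le> (\<Sum>s\<in>S k. w k s * indicator {-1<..b} s)"
      proof (intro sum_mono mult_left_mono w(1))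
        fix s assume "s \<in> S k"
        then show "1 - s / b \<le> indicator {-1<..b} s"
          using S(2)[of s k] \<open>0 < b\<close> by (auto simp: indicator_def)
      qed
      also have "\<dots> = measure (\<mu> k) {-1<..b}"
        using int[of "indicator {-1<..b}" k] by simp
      finally show ?thesis .
    qed
    moreover have "-1 < b"
      using \<open>0 < b\<close> by simp
    ultimately show "\<exists>a b. a < b \<and> (\<forall>k. 1 - e < measure (\<mu> k) {a<..b})"
      by blast
  qed
  from tight_imp_convergent_subsubsequence[OF this strict_mono_id]
  obtain r \<rho> where r: "strict_mono (r :: nat \<Rightarrow> nat)" and \<rho>: "real_distribution \<rho>"
    and weak: "weak_conv_m (\<mu> \<circ> id \<circ> r) \<rho>"
    by blast
  interpret \<rho>: real_distribution \<rho> by (rule \<rho>)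
  have weak_int: "(\<lambda>k. \<Sum>s\<in>S (r k). w (r k) s * f s) \<longlonglongrightarrow> integral\<^sup>L \<rho> f"
    if f: "continuous_on UNIV f" "\<And>s. \<bar>f s\<bar> \<le> K" for f :: "real \<Rightarrow> real" and K
  proof -
    have "(\<lambda>k. integral\<^sup>L ((\<mu> \<circ> id \<circ> r) k) f) \<longlonglongrightarrow> integral\<^sup>L \<rho> f"
      by (rule weak_conv_imp_integral_bdd_continuous_conv[OF _ \<rho> weak, of f K])
         (use \<mu> f in \<open>auto simp: continuous_on_eq_continuous_at\<close>)
    moreover have "f \<in> borel_measurable borel"
      by (rule borel_measurable_continuous_onI[OF f(1)])
    ultimately show ?thesis
      by (simp add: int)
  qed
  have pos: "AE s in \<rho>. 0 \<le> s"
  proof -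
    \<comment> \<open>A bounded continuous function that is positive exactly on the negative
      half-line: it vanishes on every \<open>S k\<close>, so its integral against the weak limit is
      0.\<close>
    define f :: "real \<Rightarrow> real" where "f s = min 1 (max 0 (- s))" for s
    have cont: "continuous_on UNIV f"
      unfolding f_def by (intro continuous_intros)
    have "(\<Sum>s\<in>S (r k). w (r k) s * f s) = 0" for k
      using S(2) by (intro sum.neutral) (auto simp: f_def)
    moreover have "(\<lambda>k. \<Sum>s\<in>S (r k). w (r k) s * f s) \<longlonglongrightarrow> integral\<^sup>L \<rho> f"
      by (rule weak_int[OF cont, of 1]) (auto simp: f_def)
    ultimately have "integral\<^sup>L \<rho> f = 0"
      by (simp add: LIMSEQ_const_iff)
    moreover have "integrable \<rho> f"
      by (rule \<rho>.integrable_const_bound[of _ 1])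
         (use borel_measurable_continuous_onI[OF cont] in \<open>auto simp: f_def\<close>)
    ultimately have "AE s in \<rho>. f s = 0"
      by (subst (asm) integral_nonneg_eq_0_iff_AE) (auto simp: f_def)
    then show ?thesis
      by eventually_elim (auto simp: f_def min_def max_def split: if_splits)
  qed
  have moments: "has_bochner_integral \<rho> (\<lambda>s. s ^ n) (\<gamma> n)" for n
  proof -
    \<comment> \<open>Weak convergence tests only bounded continuous functions on the whole line,
      hence the cut at j from above and the replacement of s by its positive part.\<close>
    define f where "f j s = min ((max 0 s) ^ n) (real j)" for j and s :: real
    have meas [measurable]: "f j \<in> borel_measurable borel" for j
      unfolding f_def by measurable
    have int_f: "integrable \<rho> (f j)" for j
      by (rule \<rho>.integrable_const_bound[of _ "real j"])
         (use meas in \<open>auto simp: f_def\<close>)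
    \<comment> \<open>The truncation error is bounded uniformly in k: where s^n exceeds j, s^n is at
      most s^(2n) / j. The bound survives the limit along \<open>r\<close> because the moments of
      order 2n converge too.\<close>
    have cut: "\<bar>\<gamma> n - integral\<^sup>L \<rho> (f j)\<bar> \<le> \<gamma> (2 * n) / real j" if "0 < j" for j
    proof -
      have cont: "continuous_on UNIV (f j)"
        unfolding f_def by (intro continuous_intros)
      have "\<bar>m n k - (\<Sum>s\<in>S k. w k s * f j s)\<bar> \<le> m (2 * n) k / real j" for k
      proof -
        have "\<bar>s ^ n - f j s\<bar> \<le> s ^ (2 * n) / real j" if "0 \<le> s" for s
        proof (cases "s ^ n \<le> real j")
          case True
          with that show ?thesis by (simp add: f_def)
        next
          case False
          then have "real j * (s ^ n) \<le> s ^ n * s ^ n"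
            using that by (intro mult_right_mono) auto
          then have "s ^ n \<le> s ^ (2 * n) / real j"
            using \<open>0 < j\<close> by (simp add: le_divide_eq power_mult power2_eq_square mult_2 power_add
                mult.commute)
          moreover have "\<bar>s ^ n - f j s\<bar> \<le> s ^ n"
            using False that by (simp add: f_def)
          ultimately show ?thesis by simp
        qed
        then have "(\<Sum>s\<in>S k. w k s * \<bar>s ^ n - f j s\<bar>) \<le> (\<Sum>s\<in>S k. w k s * (s ^ (2 * n) / real j))"
          using S w by (intro sum_mono mult_left_mono) auto
        moreover have "\<bar>m n k - (\<Sum>s\<in>S k. w k s * f j s)\<bar> \<le> (\<Sum>s\<in>S k. w k s * \<bar>s ^ n - f j s\<bar>)"
        proof -
          have "m n k - (\<Sum>s\<in>S k. w k s * f j s) = (\<Sum>s\<in>S k. w k s * (s ^ n - f j s))"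
            by (simp add: m_def sum_subtractf right_diff_distrib)
          also have "\<bar>\<dots>\<bar> \<le> (\<Sum>s\<in>S k. \<bar>w k s * (s ^ n - f j s)\<bar>)"
            by (rule sum_abs)
          also have "\<dots> = (\<Sum>s\<in>S k. w k s * \<bar>s ^ n - f j s\<bar>)"
            using w(1) by (intro sum.cong) (auto simp: abs_mult)
          finally show ?thesis .
        qed
        ultimately show ?thesis
          by (simp add: m_def sum_divide_distrib)
      qed
      moreover have "(\<lambda>k. m n (r k)) \<longlonglongrightarrow> \<gamma> n" "(\<lambda>k. m (2 * n) (r k)) \<longlonglongrightarrow> \<gamma> (2 * n)"
        using LIMSEQ_subseq_LIMSEQ[OF mom r] by (auto simp: o_def)
      moreover have "(\<lambda>k. \<Sum>s\<in>S (r k). w (r k) s * f j s) \<longlonglongrightarrow> integral\<^sup>L \<rho> (f j)"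
        by (rule weak_int[OF cont, of "real j"]) (auto simp: f_def)
      ultimately show ?thesis
        by (intro LIMSEQ_le[of "\<lambda>k. \<bar>m n (r k) - (\<Sum>s\<in>S (r k). w (r k) s * f j s)\<bar>" _
              "\<lambda>k. m (2 * n) (r k) / real j"] tendsto_rabs tendsto_diff tendsto_divide tendsto_const)
           (use that in auto)
    qed
    have lim: "(\<lambda>j. integral\<^sup>L \<rho> (f j)) \<longlonglongrightarrow> \<gamma> n"
    proof -
      have "(\<lambda>j. integral\<^sup>L \<rho> (f j) - \<gamma> n) \<longlonglongrightarrow> 0"
      proof (rule Lim_null_comparison)
        show "\<forall>\<^sub>F j in sequentially. norm (integral\<^sup>L \<rho> (f j) - \<gamma> n) \<le> \<gamma> (2 * n) / real j"
          using eventually_gt_at_top[of 0] by eventually_elim (use cut in \<open>simp add: abs_minus_commute\<close>)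
        show "(\<lambda>j. \<gamma> (2 * n) / real j) \<longlonglongrightarrow> 0"
          by (rule lim_const_over_n)
      qed
      then show ?thesis
        by (simp add: LIM_zero_iff)
    qed
    have "(\<lambda>j. f j s) \<longlonglongrightarrow> max 0 s ^ n" for s
    proof -
      obtain J where "max 0 s ^ n < real J"
        using reals_Archimedean2 by blast
      then have "\<forall>\<^sub>F j in sequentially. f j s = max 0 s ^ n"
        unfolding eventually_sequentially f_def by (intro exI[of _ J]) auto
      then show ?thesis
        by (rule tendsto_eventually)
    qed
    then have conv: "AE s in \<rho>. (\<lambda>j. f j s) \<longlonglongrightarrow> max 0 s ^ n"
      by simp
    have mono: "AE s in \<rho>. mono (\<lambda>j. f j s)"
      by (intro AE_I2 monoI) (auto simp: f_def)
    have max_meas: "(\<lambda>s. max 0 s ^ n) \<in> borel_measurable \<rho>"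
      by (intro \<rho>.measurable_finite_borel) measurable
    \<comment> \<open>The integrals of the increasing truncations already converge to
      \<open>\<gamma> n\<close>, so monotone convergence provides integrability together with the
      value.\<close>
    have "has_bochner_integral \<rho> (\<lambda>s. max 0 s ^ n) (\<gamma> n)"
      using integrable_monotone_convergence[OF int_f mono conv lim max_meas]
        integral_monotone_convergence[OF int_f mono conv lim max_meas]
      by (simp add: has_bochner_integral_iff)
    then show ?thesis
      by (rule has_bochner_integral_cong_AE[THEN iffD1, rotated 3])
         (use pos in \<open>auto intro!: \<rho>.measurable_finite_borel\<close>)
  qed
  show thesis
    by (rule that[OF \<rho> pos moments])
qed

text \<open>The case in which the sequence cannot be normalised to a probability measure. A perfect
  square gives t^n \<le> d t^(2n) + 1 / (4 d) for every d > 0; \<open>\<gamma> 0 = 0\<close> erases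
  the constant, and d tends to 0.\<close>

lemma nonneg_functional_zero:
  assumes \<gamma>: "nonneg_functional \<gamma>" "\<gamma> 0 = 0"
  shows "\<gamma> n = 0"
proof (cases "n = 0")
  case False
  have pos: "0 \<le> \<gamma> k" for k
  proof -
    have "(\<Sum>i<Suc k. (if i = k then 1 else 0) * f i) = f k" for f :: "nat \<Rightarrow> real"
      by (simp add: if_distrib[of "\<lambda>c. c * _"] sum.delta cong: if_cong)
    then show ?thesis
      using \<gamma>(1)[unfolded nonneg_functional_def, rule_format,
          of "\<lambda>i. if i = k then 1 else 0" "Suc k"] by (simp del: sum.lessThan_Suc)
  qed
  have bound: "\<gamma> n \<le> d * \<gamma> (2 * n)" if "0 < d" for d
  proof -
    \<comment> \<open>The coefficients of d (t^n - 1 / (2 d))^2, written as a sum of three Kronecker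
      deltas.\<close>
    define a where "a i = d * (if i = 2 * n then 1 else 0) - (if i = n then 1 else 0)
        + 1 / (4 * d) * (if i = 0 then 1 else 0)" for i :: nat
    have a: "(\<Sum>i<Suc (2 * n). a i * f i) = d * f (2 * n) - f n + 1 / (4 * d) * f 0"
      for f :: "nat \<Rightarrow> real"
    proof -
      have delta: "(\<Sum>i<Suc (2 * n). (if i = k then 1 else 0) * f i) = f k" if "k \<le> 2 * n" for k
        using that by (simp add: if_distrib[of "\<lambda>c. c * _"] sum.delta del: sum.lessThan_Suc
            cong: if_cong)
      show ?thesis
        unfolding a_def distrib_right left_diff_distrib sum.distrib sum_subtractf mult.assoc
          sum_distrib_left[symmetric] using delta[of "2 * n"] delta[of n] delta[of 0]
        by (simp del: sum.lessThan_Suc)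
    qed
    have "0 \<le> (\<Sum>i<Suc (2 * n). a i * t ^ i)" for t :: real
    proof -
      have "0 \<le> d * (t ^ n - 1 / (2 * d))\<^sup>2"
        using \<open>0 < d\<close> by simp
      also have "\<dots> = d * (t ^ n)\<^sup>2 - t ^ n + 1 / (4 * d)"
        using \<open>0 < d\<close> unfolding power2_diff by (simp add: field_simps power2_eq_square)
      also have "\<dots> = d * t ^ (2 * n) - t ^ n + 1 / (4 * d) * t ^ 0"
        by (simp add: power_mult[symmetric] mult.commute)
      finally show ?thesis
        by (simp only: a)
    qed
    then have "0 \<le> (\<Sum>i<Suc (2 * n). a i * \<gamma> i)"
      using \<gamma>(1) unfolding nonneg_functional_def by blast
    then show ?thesis
      using \<gamma>(2) by (simp add: a del: sum.lessThan_Suc)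
  qed
  have "\<gamma> n \<le> 0"
  proof (rule field_le_epsilon)
    fix e :: real assume "0 < e"
    \<comment> \<open>The summand 1 keeps the denominator positive when
      \<open>\<gamma> (2 * n)\<close> vanishes.\<close>
    define d where "d = e / (\<gamma> (2 * n) + 1)"
    have "0 < d"
      using \<open>0 < e\<close> pos[of "2 * n"] by (auto simp: d_def intro!: divide_pos_pos)
    have "\<gamma> n \<le> d * \<gamma> (2 * n)"
      using \<open>0 < d\<close> by (rule bound)
    also have "\<dots> \<le> d * (\<gamma> (2 * n) + 1)"
      using \<open>0 < d\<close> by simp
    also have "\<dots> = 0 + e"
      using pos[of "2 * n"] by (simp add: d_def)
    finally show "\<gamma> n \<le> 0 + e" .
  qed
  then show ?thesis
    using pos[of n] by simp
qed (use \<gamma> in simp)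

theorem nonneg_functional_imp_Stieltjes:
  assumes "nonneg_functional \<gamma>"
  shows "Stieltjes_moment_sequence \<gamma>"
proof (cases "\<gamma> 0 = 0")
  case True
  then have "\<gamma> n = 0" for n
    by (rule nonneg_functional_zero[OF assms])
  then show ?thesis
    unfolding Stieltjes_moment_sequence_def
    by (intro exI[of _ "null_measure (restrict_space borel {0..})"])
       (auto simp: has_bochner_integral_iff integrable_null_measure_iff
          intro!: borel_measurable_power measurable_restrict_space1)
next
  case False
  have "0 \<le> (\<Sum>n<1. 1 * \<gamma> n)"
    using assms unfolding nonneg_functional_def by (elim allE[of _ 1] allE[of _ "\<lambda>_. 1"]) auto
  then have \<gamma>0: "0 < \<gamma> 0"
    using False by simp
  have "nonneg_functional (\<lambda>n. \<gamma> n / \<gamma> 0)"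
    using assms \<gamma>0 by (auto simp: nonneg_functional_def sum_divide_distrib[symmetric])
  then obtain \<rho> where \<rho>: "real_distribution \<rho>" "AE s in \<rho>. 0 \<le> s"
    "\<And>n. has_bochner_integral \<rho> (\<lambda>s. s ^ n) (\<gamma> n / \<gamma> 0)"
    using \<gamma>0 by (elim nonneg_functional_distribution) auto
  interpret \<rho>: real_distribution \<rho> by (rule \<rho>)
  \<comment> \<open>Restriction to the half-line changes no integral because the distribution gives
    no mass to the negatives; the constant density undoes the normalisation.\<close>
  have "has_bochner_integral (density (restrict_space \<rho> {0..}) (\<lambda>_. \<gamma> 0)) (\<lambda>s. s ^ n) (\<gamma> n)" for n
  proof (rule has_bochner_integral_density)
    have "has_bochner_integral \<rho> (\<lambda>s. indicator {0..} s *\<^sub>R (\<gamma> 0 *\<^sub>R s ^ n)) (\<gamma> n)"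
      using \<rho>(2) has_bochner_integral_mult_right[OF \<rho>(3)[of n], of "\<gamma> 0"] \<gamma>0
      by (subst has_bochner_integral_cong_AE[where g = "\<lambda>s. \<gamma> 0 * s ^ n"])
         (auto elim!: eventually_mono intro!: \<rho>.measurable_finite_borel)
    then show "has_bochner_integral (restrict_space \<rho> {0..}) (\<lambda>s. \<gamma> 0 *\<^sub>R s ^ n) (\<gamma> n)"
      by (subst has_bochner_integral_restrict_space) auto
  qed (use \<gamma>0 in \<open>auto intro!: measurable_restrict_space1 \<rho>.measurable_finite_borel\<close>)
  moreover have "sets (density (restrict_space \<rho> {0..}) (\<lambda>_. \<gamma> 0)) = sets (restrict_space borel {0..})"
    by (simp add: sets_restrict_space)
  ultimately show ?thesis
    unfolding Stieltjes_moment_sequence_def by blast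
qed

lemma Stieltjes_imp_nonneg_functional:
  assumes "Stieltjes_moment_sequence \<gamma>"
  shows "nonneg_functional \<gamma>"
  unfolding nonneg_functional_def
proof (intro allI impI)
  fix N and a :: "nat \<Rightarrow> real"
  assume a: "\<forall>t\<ge>0. 0 \<le> (\<Sum>n<N. a n * t ^ n)"
  obtain \<rho> where sets: "sets \<rho> = sets (restrict_space borel {0..})"
    and \<rho>: "\<And>n. has_bochner_integral \<rho> (\<lambda>s. s ^ n) (\<gamma> n)"
    using assms by (auto simp: Stieltjes_moment_sequence_def)
  have "has_bochner_integral \<rho> (\<lambda>s. \<Sum>n<N. a n * s ^ n) (\<Sum>n<N. a n * \<gamma> n)"
    by (intro has_bochner_integral_sum has_bochner_integral_mult_right \<rho>)
  moreover have "0 \<le> (\<integral>s. (\<Sum>n<N. a n * s ^ n) \<partial>\<rho>)"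
    using a sets_eq_imp_space_eq[OF sets]
    by (intro Bochner_Integration.integral_nonneg) (simp add: space_restrict_space)
  ultimately show "0 \<le> (\<Sum>n<N. a n * \<gamma> n)"
    by (simp add: has_bochner_integral_iff)
qed

text \<open>Rational polynomials suffice: raising the coefficients of a polynomial keeps it nonnegative
  on the half-line.\<close>

lemma nonneg_functional_rat:
  assumes "\<And>cs :: rat list. (\<And>t :: real. 0 \<le> t \<Longrightarrow> 0 \<le> (\<Sum>n<length cs. of_rat (cs ! n) * t ^ n)) \<Longrightarrow>
    0 \<le> (\<Sum>n<length cs. of_rat (cs ! n) * \<gamma> n)"
  shows "nonneg_functional \<gamma>"
  unfolding nonneg_functional_def
proof (intro allI impI)
  fix N and a :: "nat \<Rightarrow> real"
  assume a: "\<forall>t\<ge>0. 0 \<le> (\<Sum>n<N. a n * t ^ n)"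
  define q where "q n k = (SOME r. a n < of_rat r \<and> of_rat r < a n + 1 / real (Suc k))" for n k
  have "a n < of_rat (q n k) \<and> of_rat (q n k) < a n + 1 / real (Suc k)" for n k
    unfolding q_def by (rule someI_ex, rule of_rat_dense) simp
  then have q: "\<And>n k. a n < of_rat (q n k)" "\<And>n k. of_rat (q n k) < a n + 1 / real (Suc k)"
    by blast+
  have "0 \<le> (\<Sum>n<N. of_rat (q n k) * \<gamma> n)" for k
  proof -
    define cs where "cs = map (\<lambda>n. q n k) [0..<N]"
    have "0 \<le> (\<Sum>n<length cs. of_rat (cs ! n) * \<gamma> n)"
    proof (rule assms)
      fix t :: real assume t: "0 \<le> t"
      have "0 \<le> (\<Sum>n<N. a n * t ^ n)"
        using a t by simp
      also have "\<dots> \<le> (\<Sum>n<N. of_rat (q n k) * t ^ n)"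
        using t q(1) by (intro sum_mono mult_right_mono) (auto intro: less_imp_le)
      finally show "0 \<le> (\<Sum>n<length cs. of_rat (cs ! n) * t ^ n)"
        by (simp add: cs_def)
    qed
    then show ?thesis
      by (simp add: cs_def)
  qed
  moreover have "(\<lambda>k. of_rat (q n k)) \<longlonglongrightarrow> a n" for n
  proof (rule tendsto_sandwich[of "\<lambda>_. a n" _ _ "\<lambda>k. a n + 1 / real (Suc k)"])
    show "(\<lambda>k. a n + 1 / real (Suc k)) \<longlonglongrightarrow> a n"
      using tendsto_add[OF tendsto_const LIMSEQ_inverse_real_of_nat, of "a n"]
      by (simp add: divide_inverse)
  qed (auto intro!: always_eventually less_imp_le q simp del: of_nat_Suc)
  then have "(\<lambda>k. \<Sum>n<N. of_rat (q n k) * \<gamma> n) \<longlonglongrightarrow> (\<Sum>n<N. a n * \<gamma> n)"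
    by (intro tendsto_intros)
  ultimately show "0 \<le> (\<Sum>n<N. a n * \<gamma> n)"
    using LIMSEQ_le_const by blast
qed

text \<open>On the half-line s^j \<le> 1 + s^n: use s^j \<le> 1 up to s = 1 and monotonicity in the
  exponent beyond. This later bounds intermediate derivatives by the outer ones.\<close>

lemma Stieltjes_moment_interpolation:
  assumes "Stieltjes_moment_sequence \<gamma>" "j \<le> n"
  shows "\<gamma> j \<le> \<gamma> 0 + \<gamma> n"
proof -
  obtain \<rho> where sets: "sets \<rho> = sets (restrict_space borel {0..})"
    and \<rho>: "\<And>n. has_bochner_integral \<rho> (\<lambda>s. s ^ n) (\<gamma> n)"
    using assms(1) by (auto simp: Stieltjes_moment_sequence_def)
  have "(\<integral>s. s ^ j \<partial>\<rho>) \<le> (\<integral>s. s ^ 0 + s ^ n \<partial>\<rho>)"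
  proof (rule integral_mono)
    fix s :: real assume "s \<in> space \<rho>"
    then have "0 \<le> s"
      using sets_eq_imp_space_eq[OF sets] by (simp add: space_restrict_space)
    then show "s ^ j \<le> s ^ 0 + s ^ n"
      using power_increasing[of j n s] power_le_one[of s j] \<open>j \<le> n\<close>
      by (cases "s \<le> 1") (auto intro: add_increasing add_increasing2)
  qed (use \<rho>[of j] has_bochner_integral_add[OF \<rho>[of 0] \<rho>[of n]] in
      \<open>auto simp: has_bochner_integral_iff\<close>)
  then show ?thesis
    using \<rho> has_bochner_integral_add[OF \<rho>[of 0] \<rho>[of n]] by (simp add: has_bochner_integral_iff)
qed

section \<open>Square integrable functions and weights\<close>

lemma square_integrable_iff:
  "f \<in> square_integrable M \<longleftrightarrow>
     f \<in> borel_measurable M \<and> (\<integral>\<^sup>+x. ennreal ((cmod (f x))\<^sup>2) \<partial>M) < \<infinity>"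
proof (cases "f \<in> borel_measurable M")
  case True
  then have "(\<lambda>x. (cmod (f x))\<^sup>2) \<in> borel_measurable M"
    by measurable
  with True show ?thesis
    by (simp add: square_integrable_def integrable_iff_bounded)
qed (simp add: square_integrable_def)

lemma square_integrable_measurable: "f \<in> square_integrable M \<Longrightarrow> f \<in> borel_measurable M"
  by (simp add: square_integrable_def)

lemma square_integrable_cong_AE:
  assumes "f \<in> borel_measurable M" "g \<in> borel_measurable M" "AE x in M. f x = g x"
  shows "f \<in> square_integrable M \<longleftrightarrow> g \<in> square_integrable M"
proof -
  have "(\<integral>\<^sup>+x. ennreal ((cmod (f x))\<^sup>2) \<partial>M) = (\<integral>\<^sup>+x. ennreal ((cmod (g x))\<^sup>2) \<partial>M)"
    using assms(3) by (intro nn_integral_cong_AE) auto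
  with assms show ?thesis
    by (simp add: square_integrable_iff)
qed

lemma square_integrable_bound:
  assumes "f \<in> square_integrable M" "g \<in> borel_measurable M"
    and "\<And>x. x \<in> space M \<Longrightarrow> cmod (g x) \<le> cmod (f x)"
  shows "g \<in> square_integrable M"
proof -
  have "(\<integral>\<^sup>+x. ennreal ((cmod (g x))\<^sup>2) \<partial>M) \<le> (\<integral>\<^sup>+x. ennreal ((cmod (f x))\<^sup>2) \<partial>M)"
    using assms(3) by (intro nn_integral_mono ennreal_leI power_mono) auto
  with assms(1,2) show ?thesis
    by (auto simp: square_integrable_iff intro: le_less_trans)
qed

lemma square_integrable_zero: "(\<lambda>x. 0) \<in> square_integrable M"
  by (simp add: square_integrable_def)

lemma square_integrable_scale:
  assumes "f \<in> square_integrable M"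
  shows "(\<lambda>x. c * f x) \<in> square_integrable M"
  using assms by (auto simp: square_integrable_def norm_mult power_mult_distrib)

lemma square_integrable_add:
  assumes "f \<in> square_integrable M" "g \<in> square_integrable M"
  shows "(\<lambda>x. f x + g x) \<in> square_integrable M"
proof -
  have [measurable]: "f \<in> borel_measurable M" "g \<in> borel_measurable M"
    using assms by (simp_all add: square_integrable_def)
  have "integrable M (\<lambda>x. 2 * (cmod (f x))\<^sup>2 + 2 * (cmod (g x))\<^sup>2)"
    using assms by (simp add: square_integrable_def)
  moreover have "(cmod (f x + g x))\<^sup>2 \<le> 2 * (cmod (f x))\<^sup>2 + 2 * (cmod (g x))\<^sup>2" for x
  proof -
    have "(cmod (f x + g x))\<^sup>2 \<le> (cmod (f x) + cmod (g x))\<^sup>2"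
      by (intro power_mono norm_triangle_ineq) auto
    also have "\<dots> \<le> 2 * (cmod (f x))\<^sup>2 + 2 * (cmod (g x))\<^sup>2"
      using sum_squares_bound[of "cmod (f x)" "cmod (g x)"] by (simp add: power2_sum)
    finally show ?thesis .
  qed
  ultimately have "integrable M (\<lambda>x. (cmod (f x + g x))\<^sup>2)"
    by (elim Bochner_Integration.integrable_bound) auto
  then show ?thesis
    by (simp add: square_integrable_def)
qed

lemma square_integrable_diff:
  assumes "f \<in> square_integrable M" "g \<in> square_integrable M"
  shows "(\<lambda>x. f x - g x) \<in> square_integrable M"
  using square_integrable_add[OF assms(1) square_integrable_scale[OF assms(2), of "-1"]] by simp

lemma L2_class_cong_AE:
  assumes "AE x in M. f x = g x"
  shows "L2_class M f = L2_class M g"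
proof -
  have "(AE x in M. u x = f x) \<longleftrightarrow> (AE x in M. u x = g x)" for u
    using assms by (auto elim: AE_mp)
  then show ?thesis
    by (simp add: L2_class_def)
qed

lemma L2_class_in_L2: "f \<in> square_integrable M \<Longrightarrow> L2_class M f \<in> L2 M"
  by (simp add: L2_def)

lemma L2_rep_L2_class:
  assumes "f \<in> square_integrable M"
  shows "L2_rep (L2_class M f) \<in> square_integrable M"
    and "AE x in M. L2_rep (L2_class M f) x = f x"
proof -
  have "f \<in> L2_class M f"
    using assms by (simp add: L2_class_def)
  then have "L2_rep (L2_class M f) \<in> L2_class M f"
    unfolding L2_rep_def by (rule someI[of "\<lambda>h. h \<in> L2_class M f"])
  then show "L2_rep (L2_class M f) \<in> square_integrable M"
    "AE x in M. L2_rep (L2_class M f) x = f x"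
    by (simp_all add: L2_class_def)
qed

lemma L2_rep_square_integrable: "F \<in> L2 M \<Longrightarrow> L2_rep F \<in> square_integrable M"
  by (auto simp: L2_def L2_rep_L2_class(1))

lemma L2_class_L2_rep: "F \<in> L2 M \<Longrightarrow> L2_class M (L2_rep F) = F"
  by (auto simp: L2_def intro!: L2_class_cong_AE L2_rep_L2_class(2))

lemma L2_add_class:
  assumes "f \<in> square_integrable M" "g \<in> square_integrable M"
  shows "L2_add M (L2_class M f) (L2_class M g) = L2_class M (\<lambda>x. f x + g x)"
  unfolding L2_add_def using L2_rep_L2_class(2)[OF assms(1)] L2_rep_L2_class(2)[OF assms(2)]
  by (intro L2_class_cong_AE) auto

lemma L2_diff_class:
  assumes "f \<in> square_integrable M" "g \<in> square_integrable M"
  shows "L2_diff M (L2_class M f) (L2_class M g) = L2_class M (\<lambda>x. f x - g x)"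
  unfolding L2_diff_def using L2_rep_L2_class(2)[OF assms(1)] L2_rep_L2_class(2)[OF assms(2)]
  by (intro L2_class_cong_AE) auto

lemma L2_scale_class:
  assumes "f \<in> square_integrable M"
  shows "L2_scale M c (L2_class M f) = L2_class M (\<lambda>x. c * f x)"
  unfolding L2_scale_def using L2_rep_L2_class(2)[OF assms]
  by (intro L2_class_cong_AE) auto

lemma L2_norm_class:
  assumes "f \<in> square_integrable M"
  shows "(L2_norm M (L2_class M f))\<^sup>2 = (\<integral>x. (cmod (f x))\<^sup>2 \<partial>M)"
    and "ennreal ((L2_norm M (L2_class M f))\<^sup>2) = (\<integral>\<^sup>+x. ennreal ((cmod (f x))\<^sup>2) \<partial>M)"
proof -
  have [measurable]: "f \<in> borel_measurable M" "L2_rep (L2_class M f) \<in> borel_measurable M"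
    using assms L2_rep_L2_class(1)[OF assms] by (simp_all add: square_integrable_def)
  have "(\<integral>x. (cmod (L2_rep (L2_class M f) x))\<^sup>2 \<partial>M) = (\<integral>x. (cmod (f x))\<^sup>2 \<partial>M)"
    using L2_rep_L2_class(2)[OF assms] by (intro integral_cong_AE) auto
  then show *: "(L2_norm M (L2_class M f))\<^sup>2 = (\<integral>x. (cmod (f x))\<^sup>2 \<partial>M)"
    by (simp add: L2_norm_def)
  show "ennreal ((L2_norm M (L2_class M f))\<^sup>2) = (\<integral>\<^sup>+x. ennreal ((cmod (f x))\<^sup>2) \<partial>M)"
    unfolding * using assms by (intro nn_integral_eq_integral[symmetric])
      (auto simp: square_integrable_def)
qed

lemma square_integrable_indicator:
  assumes "A \<in> sets M" "emeasure M A < \<infinity>"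
  shows "(\<lambda>x. indicator A x :: complex) \<in> square_integrable M"
proof -
  have "(\<lambda>x. ennreal ((cmod (indicator A x))\<^sup>2)) = indicator A"
    by (auto simp: indicator_def)
  then show ?thesis
    using assms by (simp add: square_integrable_iff)
qed

section \<open>Weights on a sigma-finite measure space\<close>

context sigma_finite_measure
begin

text \<open>Every member of \<open>E\<close> must vanish almost everywhere where \<open>w\<close> is
  infinite, so the indicator of a set of positive finite measure inside that region would stay away
  from \<open>E\<close>.\<close>

lemma finite_weight_of_dense:
  fixes w :: "'a \<Rightarrow> ennreal"
  assumes [measurable]: "w \<in> borel_measurable M"
    and dense: "L2_dense M E"
    and E: "\<And>F. F \<in> E \<Longrightarrow> (\<integral>\<^sup>+x. w x * ennreal ((cmod (L2_rep F x))\<^sup>2) \<partial>M) < \<infinity>"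
  shows "AE x in M. w x < \<infinity>"
proof -
  obtain A :: "nat \<Rightarrow> 'a set" where A: "range A \<subseteq> sets M" "(\<Union>i. A i) = space M"
    "\<And>i. emeasure M (A i) \<noteq> \<infinity>"
    using sigma_finite by metis
  \<comment> \<open>Sigma-finiteness cuts the region into pieces whose indicators are square
    integrable.\<close>
  define Y where "Y i = {x \<in> A i. w x = \<infinity>}" for i
  have [measurable]: "A i \<in> sets M" for i
    using A(1) by auto
  have Y_eq: "Y i = {x \<in> space M. x \<in> A i \<and> w x = \<infinity>}" for i
    using sets.sets_into_space[of "A i" M] by (auto simp: Y_def)
  have Y [measurable]: "Y i \<in> sets M" for i
    unfolding Y_eq by measurable
  have Y_fin: "emeasure M (Y i) < \<infinity>" for i
    using emeasure_mono[of "Y i" "A i" M] A(3)[of i] by (auto simp: Y_def top.not_eq_extremum)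
  have "emeasure M (Y i) = 0" for i
  proof -
    let ?f = "\<lambda>x. indicator (Y i) x :: complex"
    have f: "?f \<in> square_integrable M"
      by (rule square_integrable_indicator[OF Y Y_fin])
    have "measure M (Y i) \<le> 0"
    proof (rule field_le_epsilon)
      fix e :: real assume "0 < e"
      obtain G where G: "G \<in> E" "L2_norm M (L2_diff M (L2_class M ?f) G) < sqrt e"
        using dense L2_class_in_L2[OF f] \<open>0 < e\<close> unfolding L2_dense_def
        by (meson real_sqrt_gt_zero)
      have "G \<in> L2 M"
        using G dense by (auto simp: L2_dense_def)
      note g = L2_rep_square_integrable[OF this]
      have [measurable]: "L2_rep G \<in> borel_measurable M"
        using g by (rule square_integrable_measurable)
      have "AE x in M. w x * ennreal ((cmod (L2_rep G x))\<^sup>2) \<noteq> \<infinity>"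
        using E[OF G(1)] by (intro nn_integral_PInf_AE) auto
      then have g0: "AE x in M. x \<in> Y i \<longrightarrow> L2_rep G x = 0"
        by eventually_elim (auto simp: Y_def ennreal_top_mult split: if_splits)
      have "ennreal (measure M (Y i)) = (\<integral>\<^sup>+x. indicator (Y i) x \<partial>M)"
        using Y_fin[of i] by (simp add: emeasure_eq_ennreal_measure)
      also have "\<dots> \<le> (\<integral>\<^sup>+x. ennreal ((cmod (?f x - L2_rep G x))\<^sup>2) \<partial>M)"
        using g0 by (intro nn_integral_mono_AE) (auto elim!: eventually_mono simp: indicator_def)
      also have "\<dots> = ennreal ((L2_norm M (L2_diff M (L2_class M ?f) G))\<^sup>2)"
        using L2_diff_class[OF f g] L2_class_L2_rep[OF \<open>G \<in> L2 M\<close>]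
          L2_norm_class(2)[OF square_integrable_diff[OF f g]] by simp
      also have "\<dots> \<le> ennreal e"
      proof (rule ennreal_leI)
        have "0 \<le> L2_norm M (L2_diff M (L2_class M ?f) G)"
          by (simp add: L2_norm_def)
        then have "(L2_norm M (L2_diff M (L2_class M ?f) G))\<^sup>2 \<le> (sqrt e)\<^sup>2"
          using G(2) by (intro power_mono) auto
        then show "(L2_norm M (L2_diff M (L2_class M ?f) G))\<^sup>2 \<le> e"
          using \<open>0 < e\<close> by simp
      qed
      finally show "measure M (Y i) \<le> 0 + e"
        using \<open>0 < e\<close> by (simp add: ennreal_le_iff)
    qed
    then have "measure M (Y i) = 0"
      using measure_nonneg[of M "Y i"] by linarith
    then show ?thesis
      using Y_fin[of i] by (simp add: emeasure_eq_ennreal_measure)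
  qed
  then have "AE x in M. \<forall>i. x \<notin> Y i"
    using Y by (intro AE_all_countable[THEN iffD2] allI AE_not_in) (auto simp: null_sets_def)
  then show ?thesis
    using AE_space
  proof eventually_elim
    case (elim x)
    then show ?case
      using A(2) by (auto simp: Y_def top.not_eq_extremum)
  qed
qed

text \<open>Choose \<open>c n\<close> so that \<open>h n\<close> exceeds it only on a set of measure
  below 2^(-n), with respect to an equivalent finite measure. By Borel-Cantelli almost every point
  has \<open>h n \<le> c n\<close> for all large n, so the supremum of the quotients is finite. One
  sublevel set of \<open>w\<close> thus bounds all \<open>h n\<close> at once.\<close>

lemma common_weight:
  fixes h :: "nat \<Rightarrow> 'a \<Rightarrow> ennreal"
  assumes [measurable]: "\<And>n. h n \<in> borel_measurable M"
    and fin: "\<And>n. AE x in M. h n x < \<infinity>"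
  obtains w :: "'a \<Rightarrow> ennreal" and c :: "nat \<Rightarrow> real"
  where "w \<in> borel_measurable M" "AE x in M. w x < \<infinity>"
    "\<And>n x. h n x \<le> ennreal (c n) * w x"
proof -
  obtain g where g [measurable]: "g \<in> borel_measurable M" and "integral\<^sup>N M g \<noteq> \<infinity>"
    and g_pos: "\<And>x. x \<in> space M \<Longrightarrow> 0 < g x \<and> g x < \<infinity>"
    using Ex_finite_integrable_function by blast
  \<comment> \<open>A strictly positive integrable density: \<open>N\<close> has the null sets of
    \<open>M\<close> and finite total mass, which continuity from above along the sets
    \<open>B c\<close> requires.\<close>
  define N where "N = density M g"
  have [simp, measurable_cong]: "sets N = sets M"
    by (simp add: N_def)
  have [simp]: "space N = space M"
    by (simp add: N_def)
  interpret N: finite_measure N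
    using \<open>integral\<^sup>N M g \<noteq> \<infinity>\<close>
    by (intro finite_measureI) (simp add: N_def emeasure_density cong: nn_integral_cong)
  have AE_N: "(AE x in N. P x) \<longleftrightarrow> (AE x in M. P x)" for P
    unfolding N_def AE_density[OF g] using g_pos AE_space[of M]
    by (auto elim!: AE_mp intro!: AE_I2)
  have "\<exists>c::nat. 0 < c \<and> measure N {x \<in> space N. ennreal (real c) < h n x} < (1/2) ^ n" for n
  proof -
    define B where "B c = {x \<in> space N. ennreal (real c) < h n x}" for c :: nat
    have B [measurable]: "B c \<in> sets N" for c
      unfolding B_def by measurable
    have "decseq B"
      by (intro antimonoI) (auto simp: B_def intro: le_less_trans[rotated] ennreal_leI)
    then have "(\<lambda>c. measure N (B c)) \<longlonglongrightarrow> measure N (\<Inter>c. B c)"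
      using B by (intro N.finite_Lim_measure_decseq) auto
    moreover have "measure N (\<Inter>c. B c) = 0"
    proof -
      have "AE x in N. x \<notin> (\<Inter>c. B c)"
        using fin[of n] unfolding AE_N
      proof eventually_elim
        case (elim x)
        then obtain r where r: "h n x = ennreal r"
          by (cases "h n x") auto
        obtain c where "r \<le> real c"
          using real_arch_simple by blast
        then have "x \<notin> B c"
          using r by (auto simp: B_def not_less ennreal_leI)
        then show ?case by blast
      qed
      moreover have "(\<Inter>c. B c) \<in> sets N"
        by measurable
      ultimately have "(\<Inter>c. B c) \<in> null_sets N"
        by (simp add: AE_iff_null_sets)
      then show ?thesis
        by (rule measure_eq_0_null_sets)
    qed
    ultimately have "\<forall>\<^sub>F c in sequentially. measure N (B c) < (1/2) ^ n"
      by (intro order_tendstoD(2)) auto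
    then have "\<forall>\<^sub>F c in sequentially. 0 < c \<and> measure N (B c) < (1/2) ^ n"
      using eventually_gt_at_top[of 0] by eventually_elim simp
    then show ?thesis
      unfolding B_def by (auto simp: eventually_sequentially)
  qed
  then obtain c :: "nat \<Rightarrow> nat" where c: "\<And>n. 0 < c n"
    "\<And>n. measure N {x \<in> space N. ennreal (real (c n)) < h n x} < (1/2) ^ n"
    by metis
  define w where "w x = (SUP n. h n x * ennreal (1 / real (c n)))" for x
  show thesis
  proof
    show "w \<in> borel_measurable M"
      unfolding w_def by measurable
    show "h n x \<le> ennreal (real (c n)) * w x" for n x
    proof -
      have "ennreal (real (c n)) * ennreal (1 / real (c n)) = 1"
        using c(1)[of n] by (simp add: ennreal_mult[symmetric])
      then have "h n x = ennreal (real (c n)) * (h n x * ennreal (1 / real (c n)))"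
        by (metis mult.assoc mult.commute mult_1)
      also have "\<dots> \<le> ennreal (real (c n)) * w x"
        unfolding w_def by (intro mult_left_mono SUP_upper) auto
      finally show ?thesis .
    qed
    have "AE x in N. \<forall>\<^sub>F n in sequentially.
        x \<in> space N - {x \<in> space N. ennreal (real (c n)) < h n x}"
    proof (rule borel_cantelli_AE1)
      show "summable (\<lambda>n. measure N {x \<in> space N. ennreal (real (c n)) < h n x})"
        by (rule summable_comparison_test'[OF summable_geometric[of "1/2::real"], of 0])
           (use c(2) in \<open>auto intro: less_imp_le\<close>)
      show "emeasure N {x \<in> space N. ennreal (real (c n)) < h n x} < \<infinity>" for n
        by (simp add: less_top[symmetric])
    qed measurable
    moreover have "AE x in N. \<forall>n. h n x < \<infinity>"
      unfolding AE_N AE_all_countable using fin by blast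
    ultimately have "AE x in N. w x < \<infinity>"
    proof eventually_elim
      case (elim x)
      then obtain K where K: "\<And>n. K \<le> n \<Longrightarrow> h n x \<le> ennreal (real (c n))"
        by (auto simp: eventually_sequentially not_less)
      \<comment> \<open>The finitely many early indices are absorbed by their sum, the later ones by
        1.\<close>
      have "h n x * ennreal (1 / real (c n)) \<le> 1 + (\<Sum>n<K. h n x * ennreal (1 / real (c n)))" for n
      proof (cases "n < K")
        case True
        then have "h n x * ennreal (1 / real (c n)) \<le> (\<Sum>n<K. h n x * ennreal (1 / real (c n)))"
          by (intro member_le_sum) auto
        then show ?thesis
          by (rule order_trans) simp
      next
        case False
        then have "h n x * ennreal (1 / real (c n)) \<le> ennreal (real (c n)) * ennreal (1 / real (c n))"
          by (intro mult_right_mono K) auto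
        also have "\<dots> = 1"
          using c(1)[of n] by (simp add: ennreal_mult[symmetric])
        finally show ?thesis
          by (rule order_trans) simp
      qed
      then have "w x \<le> 1 + (\<Sum>n<K. h n x * ennreal (1 / real (c n)))"
        unfolding w_def by (rule SUP_least)
      also have "\<dots> < \<infinity>"
        using elim(2) by (simp add: ennreal_mult_less_top)
      finally show ?case .
    qed
    then show "AE x in M. w x < \<infinity>"
      unfolding AE_N .
  qed
qed

text \<open>At almost every point \<open>w\<close> is finite, so the indicator is eventually 0;
  \<open>u\<close> dominates. This controls the error of truncating to sublevel sets of
  \<open>w\<close>.\<close>

lemma nn_integral_tail_tendsto_0:
  fixes u w :: "'a \<Rightarrow> ennreal"
  assumes [measurable]: "u \<in> borel_measurable M" "w \<in> borel_measurable M"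
    and fin: "(\<integral>\<^sup>+x. u x \<partial>M) < \<infinity>" "AE x in M. w x < \<infinity>"
  shows "(\<lambda>k. \<integral>\<^sup>+x. u x * indicator {x. of_nat k < w x} x \<partial>M) \<longlonglongrightarrow> 0"
proof -
  have "(\<lambda>k. \<integral>\<^sup>+x. u x * indicator {x. of_nat k < w x} x \<partial>M) \<longlonglongrightarrow> (\<integral>\<^sup>+x. 0 \<partial>M)"
  proof (rule nn_integral_dominated_convergence[where w = u])
    show "AE x in M. (\<lambda>k. u x * indicator {x. of_nat k < w x} x) \<longlonglongrightarrow> 0"
      using fin(2)
    proof eventually_elim
      case (elim x)
      then obtain r where r: "w x = ennreal r"
        by (cases "w x") auto
      obtain K where "r \<le> real K"
        using real_arch_simple by blast
      then have "w x \<le> of_nat k" if "K \<le> k" for k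
        using r that by (simp add: ennreal_of_nat_eq_real_of_nat ennreal_leI)
      then have "\<forall>\<^sub>F k in sequentially. u x * indicator {x. of_nat k < w x} x = 0"
        unfolding eventually_sequentially by (intro exI[of _ K]) (auto simp: indicator_def not_less[symmetric])
      then show ?case
        by (rule tendsto_eventually)
    qed
  qed (use fin in \<open>auto simp: indicator_def\<close>)
  then show ?thesis
    by simp
qed

end

section \<open>Powers of composition operators\<close>

locale nonsingular_map = sigma_finite_measure M for M :: "'a measure" +
  fixes \<phi> :: "'a \<Rightarrow> 'a"
  assumes nonsingular: "nonsingular M \<phi>"
begin

abbreviation "C \<equiv> comp_op M \<phi>"
abbreviation "h n \<equiv> h_fun M (\<phi> ^^ n)"

lemma funpow_measurable [measurable]: "\<phi> ^^ n \<in> measurable M M"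
proof -
  have [measurable]: "\<phi> \<in> measurable M M"
    using nonsingular by (simp add: nonsingular_def)
  show ?thesis
    by (induction n) (auto simp: id_def intro: measurable_comp)
qed

lemma funpow_null_sets: "A \<in> null_sets M \<Longrightarrow> (\<phi> ^^ n) -` A \<inter> space M \<in> null_sets M"
proof (induction n arbitrary: A)
  case 0
  then show ?case
    by (simp add: null_sets.Int_space_eq2)
next
  case (Suc n)
  have \<phi> [measurable]: "\<phi> \<in> measurable M M"
    using nonsingular by (simp add: nonsingular_def)
  have "A \<in> null_sets (distr M M \<phi>)"
    using nonsingular Suc.prems by (auto simp: nonsingular_def absolutely_continuous_def)
  then have "\<phi> -` A \<inter> space M \<in> null_sets M"
    by (simp add: null_sets_distr_iff)
  then have "(\<phi> ^^ n) -` (\<phi> -` A \<inter> space M) \<inter> space M \<in> null_sets M"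
    by (rule Suc.IH)
  moreover have "(\<phi> ^^ n) -` (\<phi> -` A \<inter> space M) \<inter> space M = (\<phi> ^^ Suc n) -` A \<inter> space M"
    using measurable_space[OF funpow_measurable[of n]] by auto
  ultimately show ?case by (simp only:)
qed

lemma funpow_absolutely_continuous: "absolutely_continuous M (distr M M (\<phi> ^^ n))"
proof -
  have "A \<in> null_sets (distr M M (\<phi> ^^ n))" if "A \<in> null_sets M" for A
    using funpow_null_sets[OF that, of n] that by (simp add: null_sets_distr_iff null_setsD2)
  then show ?thesis
    by (auto simp: absolutely_continuous_def)
qed

lemma AE_funpow: "AE x in M. P x \<Longrightarrow> AE x in M. P ((\<phi> ^^ n) x)"
proof -
  assume "AE x in M. P x"
  then obtain A where "A \<in> null_sets M" "{x \<in> space M. \<not> P x} \<subseteq> A"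
    by (auto simp: eventually_ae_filter)
  then show ?thesis
    using measurable_space[OF funpow_measurable[of n]]
    by (intro AE_I'[OF funpow_null_sets[of A n]]) auto
qed

lemma h_measurable [measurable]: "h n \<in> borel_measurable M"
  by (simp add: h_fun_def)

text \<open>Stated for extended nonnegative integrals, so that it holds even where
  \<open>h n\<close> is infinite.\<close>

lemma nn_integral_funpow:
  assumes [measurable]: "f \<in> borel_measurable M"
  shows "(\<integral>\<^sup>+x. f ((\<phi> ^^ n) x) \<partial>M) = (\<integral>\<^sup>+x. h n x * f x \<partial>M)"
  using RN_deriv_nn_integral[OF funpow_absolutely_continuous[of n], of f]
  by (simp add: h_fun_def nn_integral_distr)

lemma emeasure_funpow_vimage:
  assumes A [measurable]: "A \<in> sets M"
  shows "emeasure M ((\<phi> ^^ n) -` A \<inter> space M) = (\<integral>\<^sup>+x. h n x * indicator A x \<partial>M)"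
proof -
  have "emeasure M ((\<phi> ^^ n) -` A \<inter> space M) = (\<integral>\<^sup>+x. indicator ((\<phi> ^^ n) -` A \<inter> space M) x \<partial>M)"
    by simp
  also have "\<dots> = (\<integral>\<^sup>+x. indicator A ((\<phi> ^^ n) x) \<partial>M)"
    by (intro nn_integral_cong) (auto simp: indicator_def)
  finally show ?thesis
    by (simp add: nn_integral_funpow)
qed

lemma h_0: "AE x in M. h 0 x = 1"
proof -
  have "\<phi> ^^ 0 = (\<lambda>x. x)"
    by auto
  then have "density M (\<lambda>_. 1) = distr M M (\<phi> ^^ 0)"
    by (simp only: density_1 distr_id)
  from RN_deriv_unique[OF _ this] show ?thesis
    unfolding h_fun_def by (simp only: eq_commute[of 1] borel_measurable_const)
qed

text \<open>Turns every question about domains into integrability with weight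
  \<open>h n\<close>.\<close>

lemma comp_funpow_square_integrable_iff:
  assumes [measurable]: "f \<in> borel_measurable M"
  shows "f \<circ> \<phi> ^^ n \<in> square_integrable M \<longleftrightarrow>
    (\<integral>\<^sup>+x. h n x * ennreal ((cmod (f x))\<^sup>2) \<partial>M) < \<infinity>"
proof -
  have "(\<integral>\<^sup>+x. ennreal ((cmod ((f \<circ> \<phi> ^^ n) x))\<^sup>2) \<partial>M) = (\<integral>\<^sup>+x. h n x * ennreal ((cmod (f x))\<^sup>2) \<partial>M)"
    using nn_integral_funpow[of "\<lambda>x. ennreal ((cmod (f x))\<^sup>2)" n] by simp
  moreover have "f \<circ> \<phi> ^^ n \<in> borel_measurable M"
    by (rule measurable_comp[OF funpow_measurable]) simp
  ultimately show ?thesis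
    by (simp add: square_integrable_iff)
qed

lemma comp_funpow_cong_AE:
  assumes [measurable]: "f \<in> borel_measurable M" "g \<in> borel_measurable M"
    and ae: "AE x in M. f x = g x"
  shows "f \<circ> \<phi> ^^ n \<in> square_integrable M \<longleftrightarrow> g \<circ> \<phi> ^^ n \<in> square_integrable M"
    and "L2_class M (f \<circ> \<phi> ^^ n) = L2_class M (g \<circ> \<phi> ^^ n)"
proof -
  have *: "AE x in M. (f \<circ> \<phi> ^^ n) x = (g \<circ> \<phi> ^^ n) x"
    unfolding comp_apply by (rule AE_funpow[OF ae])
  show "L2_class M (f \<circ> \<phi> ^^ n) = L2_class M (g \<circ> \<phi> ^^ n)"
    using * by (rule L2_class_cong_AE)
  show "f \<circ> \<phi> ^^ n \<in> square_integrable M \<longleftrightarrow> g \<circ> \<phi> ^^ n \<in> square_integrable M"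
    using * by (intro square_integrable_cong_AE measurable_comp[OF funpow_measurable]) auto
qed

text \<open>All composites up to n must be square integrable, since each application of
  \<open>C\<close> tests its own domain. \<open>C\<close> also chooses a fresh representative of the
  intermediate class; nonsingularity makes that choice immaterial.\<close>

lemma op_power_eq:
  "op_power M C n F =
    (if F \<in> L2 M \<and> (\<forall>j\<le>n. L2_rep F \<circ> \<phi> ^^ j \<in> square_integrable M)
     then Some (L2_class M (L2_rep F \<circ> \<phi> ^^ n)) else None)"
proof (induction n)
  case 0
  then show ?case
    by (auto simp: restrict_map_def L2_rep_square_integrable L2_class_L2_rep)
next
  case (Suc n)
  \<comment> \<open>An opaque name for the domain test, so that the simplifier splits the range of j
    without rewriting the iterates.\<close>
  define P where "P j \<longleftrightarrow> L2_rep F \<circ> \<phi> ^^ j \<in> square_integrable M" for j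
  show ?case
  proof (cases "F \<in> L2 M \<and> (\<forall>j\<le>n. L2_rep F \<circ> \<phi> ^^ j \<in> square_integrable M)")
    case True
    define f where "f = L2_rep F \<circ> \<phi> ^^ n"
    have f: "f \<in> square_integrable M"
      using True by (simp add: f_def)
    note rep = L2_rep_L2_class[OF f]
    have eq: "f \<circ> \<phi> = L2_rep F \<circ> \<phi> ^^ Suc n"
      by (simp add: f_def funpow_swap1 fun_eq_iff)
    have "L2_rep (L2_class M f) \<circ> \<phi> \<in> square_integrable M \<longleftrightarrow> f \<circ> \<phi> \<in> square_integrable M"
      "L2_class M (L2_rep (L2_class M f) \<circ> \<phi>) = L2_class M (f \<circ> \<phi>)"
      using comp_funpow_cong_AE[OF square_integrable_measurable[OF rep(1)]
          square_integrable_measurable[OF f] rep(2), of 1] by auto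
    then have "C (L2_class M f) = (if L2_rep F \<circ> \<phi> ^^ Suc n \<in> square_integrable M
        then Some (L2_class M (L2_rep F \<circ> \<phi> ^^ Suc n)) else None)"
      using L2_class_in_L2[OF f] unfolding comp_op_def eq by simp
    moreover have "op_power M C n F = Some (L2_class M f)"
      unfolding f_def Suc.IH by (rule if_P[OF True])
    then have "op_power M C (Suc n) F = C (L2_class M f)"
      by (simp add: map_comp_def)
    ultimately show ?thesis
      using True unfolding P_def[symmetric] by (auto simp: le_Suc_eq simp del: funpow.simps op_power.simps)
  next
    case False
    have "op_power M C n F = None"
      unfolding Suc.IH by (rule if_not_P[OF False])
    then have "op_power M C (Suc n) F = None"
      by (simp add: map_comp_def)
    then show ?thesis
      using False unfolding P_def[symmetric] by (auto simp: le_Suc_eq simp del: funpow.simps op_power.simps)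
  qed
qed

lemma op_power_L2_class:
  assumes f: "f \<in> square_integrable M"
  shows "op_power M C n (L2_class M f) =
    (if \<forall>j\<le>n. f \<circ> \<phi> ^^ j \<in> square_integrable M then Some (L2_class M (f \<circ> \<phi> ^^ n)) else None)"
  using comp_funpow_cong_AE[OF square_integrable_measurable[OF L2_rep_L2_class(1)[OF f]]
      square_integrable_measurable[OF f] L2_rep_L2_class(2)[OF f]]
  by (simp add: op_power_eq L2_class_in_L2[OF f])

lemma dom_op_power:
  "dom (op_power M C n) = {L2_class M f |f. \<forall>j\<le>n. f \<circ> \<phi> ^^ j \<in> square_integrable M}"
proof (intro set_eqI iffI)
  fix F assume "F \<in> dom (op_power M C n)"
  then have "F \<in> L2 M" "\<forall>j\<le>n. L2_rep F \<circ> \<phi> ^^ j \<in> square_integrable M"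
    by (auto simp: op_power_eq dom_def split: if_splits)
  then show "F \<in> {L2_class M f |f. \<forall>j\<le>n. f \<circ> \<phi> ^^ j \<in> square_integrable M}"
    using L2_class_L2_rep[of F M] by (auto intro!: exI[of _ "L2_rep F"])
next
  fix F assume "F \<in> {L2_class M f |f. \<forall>j\<le>n. f \<circ> \<phi> ^^ j \<in> square_integrable M}"
  then obtain f where f: "F = L2_class M f" "\<And>j. j \<le> n \<Longrightarrow> f \<circ> \<phi> ^^ j \<in> square_integrable M"
    by blast
  moreover from f(2)[of 0] have "f \<in> square_integrable M" by simp
  ultimately show "F \<in> dom (op_power M C n)"
    by (auto simp: op_power_L2_class)
qed

lemma L2_class_in_dom_infinity:
  assumes "f \<in> square_integrable M"
  shows "L2_class M f \<in> dom_infinity M C \<longleftrightarrow> (\<forall>j. f \<circ> \<phi> ^^ j \<in> square_integrable M)"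
  unfolding dom_infinity_def by (auto simp: op_power_L2_class[OF assms] dom_def)

lemma dom_infinity_cases:
  assumes "F \<in> dom_infinity M C"
  obtains f where "F = L2_class M f" "\<And>j. f \<circ> \<phi> ^^ j \<in> square_integrable M"
    "f \<in> square_integrable M"
proof -
  have dom: "F \<in> dom (op_power M C n)" for n
    using assms by (auto simp: dom_infinity_def)
  have F: "F \<in> L2 M" "L2_rep F \<circ> \<phi> ^^ n \<in> square_integrable M" for n
    using dom[of n] by (auto simp: op_power_eq dom_def split: if_splits)
  then show thesis
    using that[of "L2_rep F"] L2_class_L2_rep[OF F(1)] L2_rep_square_integrable[OF F(1)] by simp
qed

lemma dom_infinity_subspace: "L2_subspace M (dom_infinity M C)"
  unfolding L2_subspace_def
proof (intro conjI ballI allI)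
  show "dom_infinity M C \<subseteq> L2 M"
    by (auto elim!: dom_infinity_cases intro: L2_class_in_L2)
  show "L2_zero M \<in> dom_infinity M C"
    unfolding L2_zero_def
    by (simp add: L2_class_in_dom_infinity square_integrable_zero comp_def)
  fix F assume "F \<in> dom_infinity M C"
  then obtain f where f: "F = L2_class M f" "\<And>j. f \<circ> \<phi> ^^ j \<in> square_integrable M"
    "f \<in> square_integrable M"
    by (rule dom_infinity_cases) blast
  show "L2_scale M c F \<in> dom_infinity M C" for c
    using square_integrable_scale[OF f(3), of c] square_integrable_scale[OF f(2), of c]
    by (simp add: f(1) L2_scale_class f(3) L2_class_in_dom_infinity comp_def)
  fix G assume "G \<in> dom_infinity M C"
  then obtain g where g: "G = L2_class M g" "\<And>j. g \<circ> \<phi> ^^ j \<in> square_integrable M"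
    "g \<in> square_integrable M"
    by (rule dom_infinity_cases) blast
  show "L2_add M F G \<in> dom_infinity M C"
    using square_integrable_add[OF f(3) g(3)] square_integrable_add[OF f(2) g(2)]
    by (simp add: f(1) g(1) L2_add_class f(3) g(3) L2_class_in_dom_infinity comp_def)
qed

lemma op_power_norm:
  assumes f: "f \<in> square_integrable M" "\<And>j. f \<circ> \<phi> ^^ j \<in> square_integrable M"
  shows "(L2_norm M (the (op_power M C n (L2_class M f))))\<^sup>2 = (\<integral>x. (cmod (f ((\<phi> ^^ n) x)))\<^sup>2 \<partial>M)"
  using f by (simp add: op_power_L2_class L2_norm_class(1))

text \<open>Finiteness of \<open>h n\<close> almost everywhere is essential here:
  \<open>enn2real\<close> would send an infinite value to 0 and lose mass.\<close>

lemma has_bochner_integral_funpow: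
  fixes f :: "'a \<Rightarrow> real"
  assumes [measurable]: "f \<in> borel_measurable M" and "\<And>x. 0 \<le> f x"
    and fin: "AE x in M. h n x < \<infinity>"
    and int: "integrable M (\<lambda>x. f ((\<phi> ^^ n) x))"
  shows "has_bochner_integral M (\<lambda>x. enn2real (h n x) * f x) (\<integral>x. f ((\<phi> ^^ n) x) \<partial>M)"
proof (rule has_bochner_integral_nn_integral)
  have "(\<integral>\<^sup>+x. ennreal (enn2real (h n x) * f x) \<partial>M) = (\<integral>\<^sup>+x. h n x * ennreal (f x) \<partial>M)"
    using fin assms(2) by (intro nn_integral_cong_AE) (auto simp: ennreal_mult elim!: eventually_mono)
  also have "\<dots> = (\<integral>\<^sup>+x. ennreal (f ((\<phi> ^^ n) x)) \<partial>M)"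
    by (rule nn_integral_funpow[symmetric]) simp
  also have "\<dots> = ennreal (\<integral>x. f ((\<phi> ^^ n) x) \<partial>M)"
    using int assms(2) by (intro nn_integral_eq_integral) auto
  finally show "(\<integral>\<^sup>+x. ennreal (enn2real (h n x) * f x) \<partial>M) = ennreal (\<integral>x. f ((\<phi> ^^ n) x) \<partial>M)" .
qed (use assms in \<open>auto intro!: Bochner_Integration.integral_nonneg\<close>)

section \<open>Finite derivatives, cores and density\<close>

lemma dense_dom_imp_h_finite:
  assumes "L2_dense M (dom (op_power M C n))"
  shows "AE x in M. h n x < \<infinity>"
proof (rule finite_weight_of_dense[OF h_measurable assms])
  fix F assume "F \<in> dom (op_power M C n)"
  then have F: "F \<in> L2 M" "L2_rep F \<circ> \<phi> ^^ n \<in> square_integrable M"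
    by (auto simp: op_power_eq dom_def split: if_splits)
  then show "(\<integral>\<^sup>+x. h n x * ennreal ((cmod (L2_rep F x))\<^sup>2) \<partial>M) < \<infinity>"
    using comp_funpow_square_integrable_iff[of "L2_rep F" n] L2_rep_square_integrable[OF F(1)]
    by (simp add: square_integrable_measurable)
qed

text \<open>Truncate f to the set where \<open>w \<le> k\<close>. There each \<open>h j\<close> is
  at most \<open>c j * k\<close>, so the truncation lies in the domain of every power, while the
  squared graph norm of the error is the tail of one integrable function.\<close>

lemma dom_infinity_core:
  assumes fin: "\<And>n. AE x in M. h n x < \<infinity>"
  shows "is_core M (dom_infinity M C) (op_power M C n)"
  unfolding is_core_def
proof (intro conjI ballI allI impI dom_infinity_subspace)
  show "dom_infinity M C \<subseteq> dom (op_power M C n)"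
    by (auto simp: dom_infinity_def)
  fix F and e :: real assume "F \<in> dom (op_power M C n)" "0 < e"
  then obtain f where F: "F = L2_class M f" and f: "\<And>j. j \<le> n \<Longrightarrow> f \<circ> \<phi> ^^ j \<in> square_integrable M"
    unfolding dom_op_power by blast
  from f[of 0] have f0: "f \<in> square_integrable M" by simp
  then have fm [measurable]: "f \<in> borel_measurable M"
    by (rule square_integrable_measurable)
  obtain w c where w [measurable]: "w \<in> borel_measurable M" "AE x in M. w x < \<infinity>"
    and c: "\<And>n x. h n x \<le> ennreal (c n) * w x"
    by (rule common_weight[of h, OF h_measurable fin]) blast
  define f2 where "f2 x = ennreal ((cmod (f x))\<^sup>2)" for x
  have [measurable]: "f2 \<in> borel_measurable M"
    unfolding f2_def by measurable
  \<comment> \<open>The integral of \<open>u\<close> is the squared graph norm of f for the n-th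
    power.\<close>
  define u where "u x = f2 x + h n x * f2 x" for x
  have "(\<integral>\<^sup>+x. u x \<partial>M) < \<infinity>"
    using f0 f[OF order_refl, unfolded comp_funpow_square_integrable_iff[OF fm]] unfolding u_def
    by (simp add: nn_integral_add square_integrable_iff f2_def)
  then have "(\<lambda>k. \<integral>\<^sup>+x. u x * indicator {x. of_nat k < w x} x \<partial>M) \<longlonglongrightarrow> 0"
    by (intro nn_integral_tail_tendsto_0 w) (simp_all add: u_def)
  then have "\<forall>\<^sub>F k in sequentially. (\<integral>\<^sup>+x. u x * indicator {x. of_nat k < w x} x \<partial>M) < ennreal (e\<^sup>2)"
    using \<open>0 < e\<close> by (intro order_tendstoD(2)) auto
  then obtain k where k: "(\<integral>\<^sup>+x. u x * indicator {x. of_nat k < w x} x \<partial>M) < ennreal (e\<^sup>2)"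
    by (auto simp: eventually_sequentially)
  define g where "g x = (if of_nat k < w x then 0 else f x)" for x
  have [measurable]: "g \<in> borel_measurable M"
    unfolding g_def by measurable
  have g0: "g \<in> square_integrable M"
    by (rule square_integrable_bound[OF f0]) (auto simp: g_def)
  have g: "g \<circ> \<phi> ^^ j \<in> square_integrable M" for j
  proof -
    have "(\<integral>\<^sup>+x. h j x * ennreal ((cmod (g x))\<^sup>2) \<partial>M)
        \<le> (\<integral>\<^sup>+x. ennreal (c j) * of_nat k * ennreal ((cmod (f x))\<^sup>2) \<partial>M)"
    proof (intro nn_integral_mono)
      fix x
      show "h j x * ennreal ((cmod (g x))\<^sup>2) \<le> ennreal (c j) * of_nat k * ennreal ((cmod (f x))\<^sup>2)"
      proof (cases "of_nat k < w x")
        case False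
        then have "h j x \<le> ennreal (c j) * of_nat k"
          by (intro order_trans[OF c] mult_left_mono) auto
        then show ?thesis
          using False by (simp add: g_def mult_right_mono)
      qed (simp add: g_def)
    qed
    also have "\<dots> < \<infinity>"
      using f0 by (simp add: nn_integral_cmult square_integrable_iff ennreal_mult_less_top
            of_nat_less_top)
    finally show ?thesis
      by (simp add: comp_funpow_square_integrable_iff)
  qed
  define d where "d x = f x - g x" for x
  have [measurable]: "d \<in> borel_measurable M"
    unfolding d_def by measurable
  have d0: "d \<in> square_integrable M"
    unfolding d_def by (rule square_integrable_diff[OF f0 g0])
  have dn: "d \<circ> \<phi> ^^ n \<in> square_integrable M"
    using square_integrable_diff[OF f[OF order_refl] g[of n]] by (simp add: d_def comp_def)
  have norm1: "L2_diff M F (L2_class M g) = L2_class M d"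
    unfolding F d_def by (rule L2_diff_class[OF f0 g0])
  have norm2: "L2_diff M (the (op_power M C n F)) (the (op_power M C n (L2_class M g))) =
      L2_class M (d \<circ> \<phi> ^^ n)"
    using f g L2_diff_class[OF f[OF order_refl] g[of n]]
    by (simp add: F op_power_L2_class f0 g0 d_def comp_def)
  have "ennreal ((L2_norm M (L2_class M d))\<^sup>2 + (L2_norm M (L2_class M (d \<circ> \<phi> ^^ n)))\<^sup>2)
      = (\<integral>\<^sup>+x. ennreal ((cmod (d x))\<^sup>2) \<partial>M) + (\<integral>\<^sup>+x. ennreal ((cmod ((d \<circ> \<phi> ^^ n) x))\<^sup>2) \<partial>M)"
    by (simp add: L2_norm_class(2)[OF d0] L2_norm_class(2)[OF dn] ennreal_plus del: comp_apply)
  also have "\<dots> = (\<integral>\<^sup>+x. ennreal ((cmod (d x))\<^sup>2) + h n x * ennreal ((cmod (d x))\<^sup>2) \<partial>M)"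
    using nn_integral_funpow[of "\<lambda>x. ennreal ((cmod (d x))\<^sup>2)" n] by (simp add: nn_integral_add)
  \<comment> \<open>The difference \<open>d\<close> is f where \<open>w\<close> exceeds k, and 0
    elsewhere.\<close>
  also have "\<dots> = (\<integral>\<^sup>+x. u x * indicator {x. of_nat k < w x} x \<partial>M)"
    by (intro nn_integral_cong) (auto simp: d_def g_def u_def f2_def indicator_def)
  also have "\<dots> < ennreal (e\<^sup>2)"
    by (rule k)
  finally have "(L2_norm M (L2_class M d))\<^sup>2 + (L2_norm M (L2_class M (d \<circ> \<phi> ^^ n)))\<^sup>2 < e\<^sup>2"
    by (subst (asm) ennreal_less_iff) auto
  then have "sqrt ((L2_norm M (L2_class M d))\<^sup>2 + (L2_norm M (L2_class M (d \<circ> \<phi> ^^ n)))\<^sup>2) < e"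
    using \<open>0 < e\<close> by (simp add: real_less_lsqrt)
  moreover have "L2_class M g \<in> dom_infinity M C"
    using g by (simp add: L2_class_in_dom_infinity g0)
  ultimately show "\<exists>G\<in>dom_infinity M C. sqrt ((L2_norm M (L2_diff M F G))\<^sup>2
      + (L2_norm M (L2_diff M (the (op_power M C n F)) (the (op_power M C n G))))\<^sup>2) < e"
    using norm1 norm2 by (intro bexI[of _ "L2_class M g"]) simp_all
qed

text \<open>Density is the core property for the power 0, the identity on the whole space.\<close>

lemma dom_infinity_dense:
  assumes fin: "\<And>n. AE x in M. h n x < \<infinity>"
  shows "L2_dense M (dom_infinity M C)"
  unfolding L2_dense_def
proof (intro conjI ballI allI impI)
  show "dom_infinity M C \<subseteq> L2 M"
    using dom_infinity_subspace by (simp add: L2_subspace_def)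
  fix F and e :: real assume "F \<in> L2 M" "0 < e"
  then have "F \<in> dom (op_power M C 0)"
    by (simp add: restrict_map_def dom_def)
  with \<open>0 < e\<close> obtain G where G: "G \<in> dom_infinity M C"
    "sqrt ((L2_norm M (L2_diff M F G))\<^sup>2
      + (L2_norm M (L2_diff M (the (op_power M C 0 F)) (the (op_power M C 0 G))))\<^sup>2) < e"
    using dom_infinity_core[OF fin, of 0] unfolding is_core_def by blast
  have "L2_norm M (L2_diff M F G) \<le> sqrt ((L2_norm M (L2_diff M F G))\<^sup>2
      + (L2_norm M (L2_diff M (the (op_power M C 0 F)) (the (op_power M C 0 G))))\<^sup>2)"
    by (rule real_le_rsqrt) simp
  from this G(2) have "L2_norm M (L2_diff M F G) < e"
    by (rule le_less_trans)
  with G(1) show "\<exists>G\<in>dom_infinity M C. L2_norm M (L2_diff M F G) < e"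
    by blast
qed

section \<open>Positivity and the four conditions\<close>

text \<open>The pivot of the equivalences. The polynomial is quantified outside the almost
  everywhere statement, so the exceptional set may depend on it.\<close>

definition positive_derivatives :: bool where
  "positive_derivatives \<longleftrightarrow> (\<forall>n. AE x in M. h n x < \<infinity>) \<and>
    (\<forall>N a. (\<forall>t\<ge>0. 0 \<le> (\<Sum>n<N. a n * t ^ n)) \<longrightarrow>
      (AE x in M. 0 \<le> (\<Sum>n<N. a n * enn2real (h n x))))"

lemma positive_derivativesD:
  assumes positive_derivatives "\<And>t. 0 \<le> t \<Longrightarrow> 0 \<le> (\<Sum>n<N. a n * t ^ n)"
  shows "AE x in M. 0 \<le> (\<Sum>n<N. a n * enn2real (h n x))"
  using assms unfolding positive_derivatives_def by simp

lemma dom_op_power_subset: "dom (op_power M C n) \<subseteq> L2 M"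
  by (auto simp: op_power_eq dom_def split: if_splits)

lemma comp_indicator_square_integrable:
  assumes A [measurable]: "A \<in> sets M" and "emeasure M ((\<phi> ^^ n) -` A \<inter> space M) < \<infinity>"
  shows "(\<lambda>x. indicator A x :: complex) \<circ> \<phi> ^^ n \<in> square_integrable M"
proof -
  have "(\<lambda>x. h n x * ennreal ((cmod (indicator A x))\<^sup>2)) = (\<lambda>x. h n x * indicator A x)"
    by (auto simp: indicator_def)
  with assms(2) show ?thesis
    unfolding emeasure_funpow_vimage[OF A] by (subst comp_funpow_square_integrable_iff) auto
qed

lemma generates_Stieltjes_imp_dense:
  assumes "generates_Stieltjes M C"
  shows "L2_dense M (dom (op_power M C k))"
proof -
  have "dom_infinity M C \<subseteq> dom (op_power M C k)"
    by (auto simp: dom_infinity_def)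
  then show ?thesis
    using assms dom_op_power_subset[of k] unfolding generates_Stieltjes_def L2_dense_def by blast
qed

text \<open>The moment property is applied to the class of the indicator of \<open>A\<close>: its
  n-th iterate is the indicator of the n-th preimage, whose squared norm is the measure.\<close>

lemma generates_Stieltjes_imp_measure:
  assumes "generates_Stieltjes M C" and A [measurable]: "A \<in> sets M"
    and fin: "\<And>k. emeasure M ((\<phi> ^^ k) -` A \<inter> space M) < \<infinity>"
  shows "Stieltjes_moment_sequence (\<lambda>n. measure M ((\<phi> ^^ n) -` A \<inter> space M))"
proof -
  let ?f = "\<lambda>x. indicator A x :: complex"
  have f: "?f \<circ> \<phi> ^^ n \<in> square_integrable M" for n
    by (rule comp_indicator_square_integrable[OF A fin])
  from f[of 0] have f0: "?f \<in> square_integrable M"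
    by (simp add: comp_def)
  have "(L2_norm M (the (op_power M C n (L2_class M ?f))))\<^sup>2 = measure M ((\<phi> ^^ n) -` A \<inter> space M)" for n
  proof -
    have "(\<integral>x. (cmod (?f ((\<phi> ^^ n) x)))\<^sup>2 \<partial>M) = (\<integral>x. indicator ((\<phi> ^^ n) -` A \<inter> space M) x \<partial>M)"
      by (intro Bochner_Integration.integral_cong) (auto simp: indicator_def)
    also have "\<dots> = measure M ((\<phi> ^^ n) -` A \<inter> space M)"
      by (simp add: Int_assoc)
    finally show ?thesis
      by (simp only: op_power_norm[OF f0 f])
  qed
  moreover have "L2_class M ?f \<in> dom_infinity M C"
    unfolding L2_class_in_dom_infinity[OF f0] using f by blast
  ultimately show ?thesis
    using assms(1) unfolding generates_Stieltjes_def by fastforce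
qed

text \<open>On a piece of the set where \<open>R\<close> is negative, all preimages of which have
  finite measure, the moment hypothesis makes the integral of \<open>R\<close> nonnegative. Hence
  each such piece is null, and countably many of them exhaust the negative set up to a null
  set.\<close>

lemma positive_derivatives_of_measure:
  assumes dense: "\<And>k. 1 \<le> k \<Longrightarrow> L2_dense M (dom (op_power M C k))"
    and Stieltjes: "\<And>A. A \<in> sets M \<Longrightarrow> (\<And>k. emeasure M ((\<phi> ^^ k) -` A \<inter> space M) < \<infinity>) \<Longrightarrow>
      Stieltjes_moment_sequence (\<lambda>n. measure M ((\<phi> ^^ n) -` A \<inter> space M))"
  shows positive_derivatives
  unfolding positive_derivatives_def
proof (intro conjI allI impI)
  show fin: "AE x in M. h n x < \<infinity>" for n
  \<comment> \<open>Density is assumed only from the first power on; for n = 0 the derivative is 1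
    almost everywhere.\<close>
  proof (cases "n = 0")
    case True
    have "AE x in M. h 0 x < \<infinity>"
      using h_0 by eventually_elim (simp only: infinity_ennreal_def ennreal_one_less_top)
    then show ?thesis
      unfolding True .
  qed (intro dense_dom_imp_h_finite dense, simp)
  fix N and a :: "nat \<Rightarrow> real"
  assume a: "\<forall>t\<ge>0. 0 \<le> (\<Sum>n<N. a n * t ^ n)"
  define R where "R x = (\<Sum>n<N. a n * enn2real (h n x))" for x
  have [measurable]: "R \<in> borel_measurable M"
    unfolding R_def by measurable
  obtain w c where w [measurable]: "w \<in> borel_measurable M" and w_fin: "AE x in M. w x < \<infinity>"
    and c: "\<And>n x. h n x \<le> ennreal (c n) * w x"
    by (rule common_weight[of h, OF h_measurable fin]) blast
  obtain Y :: "nat \<Rightarrow> 'a set" where Y: "range Y \<subseteq> sets M" "(\<Union>i. Y i) = space M"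
    "\<And>i. emeasure M (Y i) \<noteq> \<infinity>"
    using sigma_finite by metis
  have [measurable]: "Y i \<in> sets M" for i
    using Y(1) by auto
  \<comment> \<open>\<open>Y i\<close> bounds the measure and \<open>w \<le> k\<close> bounds every
    \<open>h n\<close>, so the n-th preimage has measure at most \<open>c n * k\<close> times that
    of \<open>Y i\<close>.\<close>
  define A where "A i k = {x \<in> space M. x \<in> Y i \<and> w x \<le> of_nat k \<and> R x < 0}" for i k :: nat
  have A [measurable]: "A i k \<in> sets M" for i k
    unfolding A_def by measurable
  have "AE x in M. x \<notin> A i k" for i k
  proof -
    have fin_vimage: "emeasure M ((\<phi> ^^ n) -` A i k \<inter> space M) < \<infinity>" for n
    proof -
      have "emeasure M ((\<phi> ^^ n) -` A i k \<inter> space M)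
          \<le> (\<integral>\<^sup>+x. ennreal (c n) * of_nat k * indicator (Y i) x \<partial>M)"
        unfolding emeasure_funpow_vimage[OF A]
      proof (intro nn_integral_mono)
        fix x
        show "h n x * indicator (A i k) x \<le> ennreal (c n) * of_nat k * indicator (Y i) x"
        proof (cases "x \<in> A i k")
          case True
          then have "h n x \<le> ennreal (c n) * of_nat k"
            by (intro order_trans[OF c] mult_left_mono) (auto simp: A_def)
          then show ?thesis
            using True by (simp add: A_def)
        qed simp
      qed
      also have "\<dots> < \<infinity>"
        using Y(3)[of i] by (simp add: nn_integral_cmult ennreal_mult_less_top of_nat_less_top
            top.not_eq_extremum)
      finally show ?thesis .
    qed
    have "has_bochner_integral M (\<lambda>x. enn2real (h n x) * indicator (A i k) x)
        (measure M ((\<phi> ^^ n) -` A i k \<inter> space M))" for n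
    proof -
      have ind: "indicator (A i k) ((\<phi> ^^ n) x) = (indicator ((\<phi> ^^ n) -` A i k \<inter> space M) x :: real)"
        if "x \<in> space M" for x
        using that by (auto simp: indicator_def)
      have "has_bochner_integral M (\<lambda>x. indicator (A i k) ((\<phi> ^^ n) x) :: real)
          (measure M ((\<phi> ^^ n) -` A i k \<inter> space M))"
        by (rule has_bochner_integral_cong[OF refl ind refl, THEN iffD2])
           (assumption, intro has_bochner_integral_real_indicator measurable_sets[OF funpow_measurable A] fin_vimage)
      then show ?thesis
        using has_bochner_integral_funpow[of "indicator (A i k)" n] fin[of n]
        by (simp add: has_bochner_integral_iff)
    qed
    then have "has_bochner_integral M (\<lambda>x. \<Sum>n<N. a n * (enn2real (h n x) * indicator (A i k) x))
        (\<Sum>n<N. a n * measure M ((\<phi> ^^ n) -` A i k \<inter> space M))"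
      by (intro has_bochner_integral_sum has_bochner_integral_mult_right)
    moreover have "0 \<le> (\<Sum>n<N. a n * measure M ((\<phi> ^^ n) -` A i k \<inter> space M))"
      using Stieltjes_imp_nonneg_functional[OF Stieltjes[OF A fin_vimage]] a
      unfolding nonneg_functional_def by blast
    moreover have "(\<Sum>n<N. a n * (enn2real (h n x) * indicator (A i k) x))
        = - (- R x * indicator (A i k) x)" for x
      by (simp add: R_def sum_distrib_right mult.assoc)
    ultimately have int: "integrable M (\<lambda>x. - R x * indicator (A i k) x)"
      and le: "(\<integral>x. - R x * indicator (A i k) x \<partial>M) \<le> 0"
      by (simp_all add: has_bochner_integral_iff)
    \<comment> \<open>The sign is reversed so that a nonnegative integrand has integral at most 0,
      and therefore vanishes almost everywhere.\<close>
    have nonneg: "0 \<le> - R x * indicator (A i k) x" for x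
      by (auto simp: A_def indicator_def)
    have "(\<integral>x. - R x * indicator (A i k) x \<partial>M) = 0"
      using le by (rule antisym) (intro Bochner_Integration.integral_nonneg nonneg)
    then have "AE x in M. - R x * indicator (A i k) x = 0"
      by (subst (asm) integral_nonneg_eq_0_iff_AE[OF int]) (use nonneg in auto)
    then show ?thesis
      by eventually_elim (auto simp: A_def indicator_def split: if_splits)
  qed
  then have "AE x in M. \<forall>i k. x \<notin> A i k"
    by (simp add: AE_all_countable)
  then show "AE x in M. 0 \<le> (\<Sum>n<N. a n * enn2real (h n x))"
    using w_fin AE_space
  proof eventually_elim
    case (elim x)
    obtain i where "x \<in> Y i"
      using elim(3) Y(2) by auto
    moreover obtain r where "w x = ennreal r"
      using elim(2) by (cases "w x") auto
    moreover obtain k where "r \<le> real k"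
      using real_arch_simple by blast
    ultimately have "x \<in> Y i \<and> w x \<le> of_nat k"
      by (simp add: ennreal_of_nat_eq_real_of_nat ennreal_leI)
    then have "\<not> R x < 0"
      using elim by (auto simp: A_def)
    then show ?case
      by (simp add: R_def)
  qed
qed

text \<open>Haviland's theorem is applied to the norm sequence of each vector, not pointwise in x.
  Each polynomial enters through one integral against |f|^2, so exceptional sets depending on it do
  no harm.\<close>

lemma positive_derivatives_imp_generates_Stieltjes:
  assumes positive_derivatives
  shows "generates_Stieltjes M C"
  unfolding generates_Stieltjes_def
proof (intro conjI ballI nonneg_functional_imp_Stieltjes)
  have fin: "AE x in M. h n x < \<infinity>" for n
    using assms by (simp add: positive_derivatives_def)
  then show "L2_dense M (dom_infinity M C)"
    by (rule dom_infinity_dense)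
  fix F assume "F \<in> dom_infinity M C"
  then obtain f where F: "F = L2_class M f" and f: "\<And>j. f \<circ> \<phi> ^^ j \<in> square_integrable M"
    "f \<in> square_integrable M"
    by (rule dom_infinity_cases) blast
  have [measurable]: "f \<in> borel_measurable M"
    using f(2) by (rule square_integrable_measurable)
  have int: "has_bochner_integral M (\<lambda>x. enn2real (h n x) * (cmod (f x))\<^sup>2)
      ((L2_norm M (the (op_power M C n F)))\<^sup>2)" for n
    unfolding F op_power_norm[OF f(2,1)]
    using f(1)[of n] fin[of n]
    by (intro has_bochner_integral_funpow) (auto simp: square_integrable_def)
  show "nonneg_functional (\<lambda>n. (L2_norm M (the (op_power M C n F)))\<^sup>2)"
    unfolding nonneg_functional_def
  proof (intro allI impI)
    fix N and a :: "nat \<Rightarrow> real"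
    assume "\<forall>t\<ge>0. 0 \<le> (\<Sum>n<N. a n * t ^ n)"
    then have pos: "AE x in M. 0 \<le> (\<Sum>n<N. a n * enn2real (h n x))"
      using assms by (simp add: positive_derivatives_def)
    have "has_bochner_integral M (\<lambda>x. \<Sum>n<N. a n * (enn2real (h n x) * (cmod (f x))\<^sup>2))
        (\<Sum>n<N. a n * (L2_norm M (the (op_power M C n F)))\<^sup>2)"
      by (intro has_bochner_integral_sum has_bochner_integral_mult_right int)
    moreover have "0 \<le> (\<integral>x. (\<Sum>n<N. a n * (enn2real (h n x) * (cmod (f x))\<^sup>2)) \<partial>M)"
      using pos by (intro integral_nonneg_AE, eventually_elim)
        (simp add: mult.assoc[symmetric] sum_distrib_right[symmetric])
    ultimately show "0 \<le> (\<Sum>n<N. a n * (L2_norm M (the (op_power M C n F)))\<^sup>2)"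
      by (simp add: has_bochner_integral_iff)
  qed
qed

text \<open>The exceptional sets of the rational polynomials have a null union; off it the sequence
  at x is positive on all real polynomials, and Haviland's theorem applies at x.\<close>

lemma positive_derivatives_iff_Stieltjes:
  "positive_derivatives \<longleftrightarrow> (AE x in M. (\<forall>n. h n x < \<infinity>) \<and>
     Stieltjes_moment_sequence (\<lambda>n. enn2real (h n x)))"
proof
  assume pos: positive_derivatives
  \<comment> \<open>Finite lists of rationals form a countable type, as needed to move the
    quantifier inside the almost everywhere statement.\<close>
  define Q where "Q cs \<longleftrightarrow> (\<forall>t\<ge>0. 0 \<le> (\<Sum>n<length cs. of_rat (cs ! n) * t ^ n :: real))"
    for cs :: "rat list"
  have "AE x in M. \<forall>n. h n x < \<infinity>"
    using pos by (simp add: positive_derivatives_def AE_all_countable)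
  moreover have "AE x in M. \<forall>cs. Q cs \<longrightarrow> 0 \<le> (\<Sum>n<length cs. of_rat (cs ! n) * enn2real (h n x))"
    unfolding AE_all_countable
  proof
    fix cs
    show "AE x in M. Q cs \<longrightarrow> 0 \<le> (\<Sum>n<length cs. of_rat (cs ! n) * enn2real (h n x))"
      using pos unfolding positive_derivatives_def Q_def by (cases "Q cs") (auto simp: Q_def)
  qed
  ultimately show "AE x in M. (\<forall>n. h n x < \<infinity>) \<and>
     Stieltjes_moment_sequence (\<lambda>n. enn2real (h n x))"
    by eventually_elim (auto simp: Q_def intro!: nonneg_functional_imp_Stieltjes nonneg_functional_rat)
next
  assume ae: "AE x in M. (\<forall>n. h n x < \<infinity>) \<and> Stieltjes_moment_sequence (\<lambda>n. enn2real (h n x))"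
  show positive_derivatives
    unfolding positive_derivatives_def
  proof (intro conjI allI impI)
    show "AE x in M. h n x < \<infinity>" for n
      using ae by eventually_elim blast
    fix N and a :: "nat \<Rightarrow> real"
    assume a: "\<forall>t\<ge>0. 0 \<le> (\<Sum>n<N. a n * t ^ n)"
    show "AE x in M. 0 \<le> (\<Sum>n<N. a n * enn2real (h n x))"
      using ae
    proof eventually_elim
      case (elim x)
      then have "nonneg_functional (\<lambda>n. enn2real (h n x))"
        by (intro Stieltjes_imp_nonneg_functional) blast
      then show ?case
        using a unfolding nonneg_functional_def by blast
    qed
  qed
qed

lemma positive_derivatives_iff_poly_map:
  "positive_derivatives \<longleftrightarrow> (\<forall>n\<ge>1. AE x in M. h n x < \<infinity>) \<and>
     (\<forall>p :: complex poly.
        (\<forall>t::real. 0 \<le> t \<longrightarrow> poly p (complex_of_real t) \<in> \<real>\<^sub>\<ge>\<^sub>0) \<longrightarrow>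
        (AE x in M. poly_map M \<phi> p x \<in> \<real>\<^sub>\<ge>\<^sub>0))"
proof (intro iffI conjI allI impI)
  assume pos: positive_derivatives
  then show "AE x in M. h n x < \<infinity>" for n
    by (simp add: positive_derivatives_def)
  fix p :: "complex poly"
  assume p: "\<forall>t::real. 0 \<le> t \<longrightarrow> poly p (complex_of_real t) \<in> \<real>\<^sub>\<ge>\<^sub>0"
  define N where "N = Suc (degree p)"
  have Re: "Re (\<Sum>n<N. coeff p n * complex_of_real (r n)) = (\<Sum>n<N. Re (coeff p n) * r n)"
    and Im: "Im (\<Sum>n<N. coeff p n * complex_of_real (r n)) = (\<Sum>n<N. Im (coeff p n) * r n)"
    for r :: "nat \<Rightarrow> real"
    by (simp_all add: Re_sum Im_sum)
  have poly: "poly p (complex_of_real t) = (\<Sum>n<N. coeff p n * complex_of_real (t ^ n))" for t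
    by (simp add: poly_altdef N_def lessThan_Suc_atMost del: sum.lessThan_Suc)
  have map: "poly_map M \<phi> p x = (\<Sum>n<N. coeff p n * complex_of_real (enn2real (h n x)))" for x
    by (simp add: poly_map_def N_def lessThan_Suc_atMost del: sum.lessThan_Suc)
  have nonneg: "0 \<le> (\<Sum>n<N. Re (coeff p n) * t ^ n)" "(\<Sum>n<N. Im (coeff p n) * t ^ n) = 0"
    if "0 \<le> t" for t
    using p that unfolding poly complex_nonneg_Reals_iff Re Im by blast+
  have "AE x in M. 0 \<le> (\<Sum>n<N. Re (coeff p n) * enn2real (h n x))"
    using pos nonneg(1) by (rule positive_derivativesD)
  \<comment> \<open>The imaginary parts give a polynomial vanishing on the half-line. Positivity
    applied to it and to its negative makes the imaginary part of the image vanish.\<close>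
  moreover have "AE x in M. 0 \<le> (\<Sum>n<N. Im (coeff p n) * enn2real (h n x))"
    using pos by (rule positive_derivativesD) (simp add: nonneg(2))
  moreover have "AE x in M. 0 \<le> (\<Sum>n<N. - Im (coeff p n) * enn2real (h n x))"
    using pos by (rule positive_derivativesD) (simp add: sum_negf nonneg(2))
  ultimately show "AE x in M. poly_map M \<phi> p x \<in> \<real>\<^sub>\<ge>\<^sub>0"
    unfolding map complex_nonneg_Reals_iff Re Im
    by eventually_elim (simp add: sum_negf)
next
  assume iv: "(\<forall>n\<ge>1. AE x in M. h n x < \<infinity>) \<and>
     (\<forall>p :: complex poly.
        (\<forall>t::real. 0 \<le> t \<longrightarrow> poly p (complex_of_real t) \<in> \<real>\<^sub>\<ge>\<^sub>0) \<longrightarrow>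
        (AE x in M. poly_map M \<phi> p x \<in> \<real>\<^sub>\<ge>\<^sub>0))"
  show positive_derivatives
    unfolding positive_derivatives_def
  proof (intro conjI allI impI)
    have "AE x in M. h 0 x < \<infinity>"
      using h_0 by eventually_elim (simp only: infinity_ennreal_def ennreal_one_less_top)
    then show "AE x in M. h n x < \<infinity>" for n
      using iv by (cases "n = 0") (simp_all only: One_nat_def Suc_le_eq neq0_conv)
    fix N and a :: "nat \<Rightarrow> real"
    assume a: "\<forall>t\<ge>0. 0 \<le> (\<Sum>n<N. a n * t ^ n)"
    define p where "p = (\<Sum>n<N. monom (complex_of_real (a n)) n)"
    have coeff: "coeff p n = (if n < N then complex_of_real (a n) else 0)" for n
      by (simp add: p_def coeff_sum sum.delta)
    have "poly p (complex_of_real t) = complex_of_real (\<Sum>n<N. a n * t ^ n)" for t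
      by (simp add: p_def poly_sum poly_monom)
    then have "\<forall>t::real. 0 \<le> t \<longrightarrow> poly p (complex_of_real t) \<in> \<real>\<^sub>\<ge>\<^sub>0"
      using a by (simp only: nonneg_Reals_of_real_iff)
    then have "AE x in M. poly_map M \<phi> p x \<in> \<real>\<^sub>\<ge>\<^sub>0"
      using iv by blast
    moreover have "poly_map M \<phi> p x = complex_of_real (\<Sum>n<N. a n * enn2real (h n x))" for x
    proof -
      \<comment> \<open>The degree of p may be smaller, as top coefficients may vanish.
        \<open>N\<close> is a uniform bound, and the extra coefficient at index \<open>N\<close> is
        0.\<close>
      have "degree p \<le> N"
        by (intro degree_le) (simp add: coeff)
      then have "poly_map M \<phi> p x = (\<Sum>n\<le>N. coeff p n * complex_of_real (enn2real (h n x)))"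
        by (rule poly_map_superset)
      also have "\<dots> = (\<Sum>n<N. complex_of_real (a n) * complex_of_real (enn2real (h n x)))"
        by (intro sum.mono_neutral_cong_right) (auto simp: coeff)
      finally show ?thesis
        by simp
    qed
    ultimately show "AE x in M. 0 \<le> (\<Sum>n<N. a n * enn2real (h n x))"
      by (simp only: nonneg_Reals_of_real_iff)
  qed
qed

text \<open>Only the domains can differ. Since \<open>h j \<le> 1 + h n\<close> almost everywhere,
  square integrability of f and of its n-th composite forces that of every composite in
  between.\<close>

lemma op_power_eq_comp_op:
  assumes positive_derivatives
  shows "op_power M C n = comp_op M (\<phi> ^^ n)"
proof
  fix F
  have "L2_rep F \<circ> \<phi> ^^ j \<in> square_integrable M"
    if F: "F \<in> L2 M" and n: "L2_rep F \<circ> \<phi> ^^ n \<in> square_integrable M" and "j \<le> n" for j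
  proof -
    note f = L2_rep_square_integrable[OF F]
    have fm [measurable]: "L2_rep F \<in> borel_measurable M"
      using f by (rule square_integrable_measurable)
    define f2 where "f2 x = ennreal ((cmod (L2_rep F x))\<^sup>2)" for x
    have [measurable]: "f2 \<in> borel_measurable M"
      unfolding f2_def by measurable
    have "AE x in M. h j x \<le> 1 + h n x"
      using assms[unfolded positive_derivatives_iff_Stieltjes] h_0
    proof eventually_elim
      case (elim x)
      have real: "h i x = ennreal (enn2real (h i x))" for i
        using elim(1) by simp
      have "enn2real (h j x) \<le> enn2real (h 0 x) + enn2real (h n x)"
        using Stieltjes_moment_interpolation[of "\<lambda>n. enn2real (h n x)" j n] elim(1) \<open>j \<le> n\<close> by blast
      then have "ennreal (enn2real (h j x)) \<le> ennreal (enn2real (h 0 x)) + ennreal (enn2real (h n x))"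
        by (simp only: ennreal_plus[OF enn2real_nonneg enn2real_nonneg, symmetric] ennreal_leI)
      then have "h j x \<le> h 0 x + h n x"
        unfolding real[symmetric] .
      then show ?case
        unfolding elim(2) .
    qed
    then have "(\<integral>\<^sup>+x. h j x * f2 x \<partial>M) \<le> (\<integral>\<^sup>+x. f2 x + h n x * f2 x \<partial>M)"
    proof (intro nn_integral_mono_AE, eventually_elim)
      case (elim x)
      then have "h j x * f2 x \<le> (1 + h n x) * f2 x"
        by (intro mult_right_mono) auto
      then show ?case
        by (simp add: distrib_right)
    qed
    also have "\<dots> < \<infinity>"
      using f n[unfolded comp_funpow_square_integrable_iff[OF fm]]
      by (simp add: nn_integral_add square_integrable_iff f2_def)
    finally show ?thesis
      by (simp add: comp_funpow_square_integrable_iff[OF fm] f2_def)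
  qed
  then show "op_power M C n F = comp_op M (\<phi> ^^ n) F"
    unfolding op_power_eq comp_op_def by (intro if_cong) auto
qed

end

theorem theorem10p4:
  fixes M :: "'a measure" and \<phi> :: "'a \<Rightarrow> 'a"
  assumes "sigma_finite_measure M" and "nonsingular M \<phi>"
  defines "cond_i \<equiv> generates_Stieltjes M (comp_op M \<phi>)"
  defines "cond_ii \<equiv> (AE x in M. (\<forall>n. h_fun M (\<phi> ^^ n) x < \<infinity>) \<and>
             Stieltjes_moment_sequence (\<lambda>n. enn2real (h_fun M (\<phi> ^^ n) x)))"
  defines "cond_iii \<equiv> (\<forall>k\<ge>1. L2_dense M (dom (op_power M (comp_op M \<phi>) k))) \<and>
             (\<forall>\<Delta> \<in> sets M. (\<forall>k. emeasure M ((\<phi> ^^ k) -` \<Delta> \<inter> space M) < \<infinity>) \<longrightarrow>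
                Stieltjes_moment_sequence (\<lambda>n. measure M ((\<phi> ^^ n) -` \<Delta> \<inter> space M)))"
  defines "cond_iv \<equiv> (\<forall>n\<ge>1. AE x in M. h_fun M (\<phi> ^^ n) x < \<infinity>) \<and>
             (\<forall>p :: complex poly.
                (\<forall>t::real. 0 \<le> t \<longrightarrow> poly p (complex_of_real t) \<in> \<real>\<^sub>\<ge>\<^sub>0) \<longrightarrow>
                (AE x in M. poly_map M \<phi> p x \<in> \<real>\<^sub>\<ge>\<^sub>0))"
  shows "(cond_i \<longleftrightarrow> cond_ii) \<and> (cond_i \<longleftrightarrow> cond_iii) \<and> (cond_i \<longleftrightarrow> cond_iv) \<and>
    (cond_i \<longrightarrow>
      (\<forall>n. op_power M (comp_op M \<phi>) n = comp_op M (\<phi> ^^ n) \<and>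
           is_core M (dom_infinity M (comp_op M \<phi>)) (op_power M (comp_op M \<phi>) n)))"
proof -
  interpret nonsingular_map M \<phi>
    using assms(1,2) by (simp add: nonsingular_map_def nonsingular_map_axioms_def)
  \<comment> \<open>Conditions (i) and (iii) are tied to positivity by a cycle of implications, (ii)
    and (iv) by direct equivalences.\<close>
  have "cond_i \<Longrightarrow> cond_iii"
    unfolding cond_i_def cond_iii_def
    using generates_Stieltjes_imp_dense generates_Stieltjes_imp_measure by blast
  moreover have "cond_iii \<Longrightarrow> positive_derivatives"
    unfolding cond_iii_def by (rule positive_derivatives_of_measure) auto
  moreover have "positive_derivatives \<Longrightarrow> cond_i"
    unfolding cond_i_def by (rule positive_derivatives_imp_generates_Stieltjes)
  moreover have "positive_derivatives \<longleftrightarrow> cond_ii"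
    unfolding cond_ii_def by (rule positive_derivatives_iff_Stieltjes)
  moreover have "positive_derivatives \<longleftrightarrow> cond_iv"
    unfolding cond_iv_def by (rule positive_derivatives_iff_poly_map)
  moreover have "op_power M C n = comp_op M (\<phi> ^^ n) \<and> is_core M (dom_infinity M C) (op_power M C n)"
    if positive_derivatives for n
    using op_power_eq_comp_op[OF that] dom_infinity_core that
    by (auto simp: positive_derivatives_def)
  ultimately show ?thesis
    by blast
qed

end
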